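(* Let $p>0$ and $0<h<1$, let $F_p=\{0\}\cup\{1/k^p : k=1,2,3,\ldots\}\subseteq\mathbb{R}$, and let $B_h:[0,\infty)\to\mathbb{R}$ be index-$h$ fractional Brownian motion. Then almost surely, for all $\theta\in[0,1]$ (simultaneously), $$\dim_\theta B_h(F_p)=\frac{\theta}{ph+\theta},$$ that is, $\underline{\dim}_{\,\theta} B_h(F_p)=\overline{\dim}_{\,\theta} B_h(F_p)=\frac{\theta}{ph+\theta}$. In particular, almost surely the box-counting dimension of $B_h(F_p)$ exists and $$\dim_{\mathrm B} B_h(F_p)=\frac{1}{ph+1}.$$
   Context: Index-$h$ fractional Brownian motion ($0<h<1$) is the stochastic process $B_h$ such that, almost surely, $B_h$ is continuous with $B_h(0)=0$, and the increments $B_h(x)-B_h(y)$ are stationary and Gaussian with mean $0$ and variance $|x-y|^{2h}$. For a set $E\subseteq\mathbb{R}^n$ (here $n=1$) and $0\le\theta\le 1$, with $|U|$ denoting the diameter of a set $U\subseteq\mathbb{R}^n$, the lower intermediate dimension is $$\underline{\dim}_{\,\theta}E=\inf\{s\ge 0: \text{for all }\epsilon>0\text{ and all }0<r_0<1\text{ there exist }0<r\le r_0\text{ and a cover }\{U_i\}\text{ of }E\text{ such that } r^{1/\theta}\le|U_i|\le r \text{ for all } i\text{ and }\textstyle\sum_i|U_i|^s\le\epsilon\},$$ and the upper intermediate dimension is $$\overline{\dim}_{\,\theta}E=\inf\{s\ge 0: \text{for all }\epsilon>0\text{ there exists }0<r_0<1\text{ such that for all }0<r\le r_0\text{ there is a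 cover }\{U_i\}\text{ of }E\text{ such that } r^{1/\theta}\le|U_i|\le r\text{ for all } i\text{ and }\textstyle\sum_i|U_i|^s\le\epsilon\}.$$ When $\theta=0$ there is no lower bound on the diameters of the covering sets (i.e. $r^{1/\theta}$ is read as $0$), and both definitions reduce to the Hausdorff dimension of $E$. When $\theta=1$ they give the lower and upper box-counting dimensions respectively. When the lower and upper values coincide, the common value is written $\dim_\theta E$ (and $\dim_{\mathrm B}E$ for the box-counting dimension). *)

theory Defs
  imports "HOL-Probability.Probability"
begin

(* Only the index set [0, infinity) matters; values of B at negative times are unconstrained.
   The law prescribed for B x - B y depends on |x - y| alone, which is the stationarity of the
   increments. Gaussianity is required of each increment, not jointly of several of them.
   normal_density takes the standard deviation |x - y|^h, so the variance is |x - y|^(2h);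
   for x = y the increment is identically 0 and has no density. *)
definition fractional_brownian_motion ::
    "'w measure \<Rightarrow> real \<Rightarrow> (real \<Rightarrow> 'w \<Rightarrow> real) \<Rightarrow> bool" where
  "fractional_brownian_motion M h B \<longleftrightarrow>
     prob_space M \<and>
     (\<forall>x\<ge>0. B x \<in> borel_measurable M) \<and>
     (AE \<omega> in M. continuous_on {0..} (\<lambda>x. B x \<omega>) \<and> B 0 \<omega> = 0) \<and>
     (\<forall>x\<ge>0. \<forall>y\<ge>0. x \<noteq> y \<longrightarrow>
        distributed M lborel (\<lambda>\<omega>. B x \<omega> - B y \<omega>)
          (normal_density 0 (\<bar>x - y\<bar> powr h)))"

(* Boundedness is explicit because diameter is a junk value on unbounded sets. *)
definition is_cover_within ::
    "real \<Rightarrow> real \<Rightarrow> 'a::euclidean_space set \<Rightarrow> 'a set set \<Rightarrow> bool" where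
  "is_cover_within a b E \<U> \<longleftrightarrow>
     countable \<U> \<and> E \<subseteq> \<Union>\<U> \<and> (\<forall>U\<in>\<U>. bounded U \<and> a \<le> diameter U \<and> diameter U \<le> b)"

(* Since 0 powr 0 = 0, sets of diameter 0 contribute 0 to the sum also when s = 0. This can only
   matter for theta = 0, and there it does not change the infimum over s: if the sum is below 1
   at s = 0, then the covering sets are all of diameter 0, and the sum vanishes for all s. *)
definition cover_sum :: "real \<Rightarrow> 'a::euclidean_space set set \<Rightarrow> ennreal" where
  "cover_sum s \<U> = (\<Sum>\<^sub>\<infinity>U\<in>\<U>. ennreal (diameter U powr s))"

definition lower_scale :: "real \<Rightarrow> real \<Rightarrow> real" where
  "lower_scale \<theta> r = (if \<theta> = 0 then 0 else r powr (1 / \<theta>))"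

(* The infima are taken in ereal, so that they are infinite if no exponent is admissible. *)
definition lower_intermediate_dim :: "real \<Rightarrow> 'a::euclidean_space set \<Rightarrow> ereal" where
  "lower_intermediate_dim \<theta> E = Inf {ereal s | s. 0 \<le> s \<and>
     (\<forall>\<epsilon>::real. \<epsilon> > 0 \<longrightarrow> (\<forall>r0. 0 < r0 \<and> r0 < 1 \<longrightarrow>
        (\<exists>r \<U>. 0 < r \<and> r \<le> r0 \<and> is_cover_within (lower_scale \<theta> r) r E \<U> \<and>
               cover_sum s \<U> \<le> ennreal \<epsilon>)))}"

definition upper_intermediate_dim :: "real \<Rightarrow> 'a::euclidean_space set \<Rightarrow> ereal" where
  "upper_intermediate_dim \<theta> E = Inf {ereal s | s. 0 \<le> s \<and>
     (\<forall>\<epsilon>::real. \<epsilon> > 0 \<longrightarrow> (\<exists>r0. 0 < r0 \<and> r0 < 1 \<and>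
        (\<forall>r. 0 < r \<and> r \<le> r0 \<longrightarrow>
           (\<exists>\<U>. is_cover_within (lower_scale \<theta> r) r E \<U> \<and>
                cover_sum s \<U> \<le> ennreal \<epsilon>))))}"

(* Least number of sets of diameter at most r that cover E. Meaningful for bounded E only:
   for unbounded E the infimum is over the empty set. *)
definition covering_number :: "'a::euclidean_space set \<Rightarrow> real \<Rightarrow> nat" where
  "covering_number E r = Inf {card \<U> | \<U>. finite \<U> \<and> E \<subseteq> \<Union>\<U> \<and>
     (\<forall>U\<in>\<U>. bounded U \<and> diameter U \<le> r)}"

definition lower_box_dim :: "'a::euclidean_space set \<Rightarrow> ereal" where
  "lower_box_dim E =
     Liminf (at_right 0) (\<lambda>r. ereal (ln (real (covering_number E r)) / (- ln r)))"

definition upper_box_dim :: "'a::euclidean_space set \<Rightarrow> ereal" where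
  "upper_box_dim E =
     Limsup (at_right 0) (\<lambda>r. ereal (ln (real (covering_number E r)) / (- ln r)))"

definition power_sequence_set :: "real \<Rightarrow> real set" where
  "power_sequence_set p = {0} \<union> {1 / real k powr p | k. k \<ge> 1}"

end

theory Submission
  imports Defs
begin

text \<open>
  Write \<open>y\<^sub>k = B(1/k\<^sup>p)\<close>.

  Upper bound: since \<open>y\<^sub>k\<close> is centred Gaussian with standard deviation \<open>k\<^bsup>-ph\<^esup>\<close>, its even
  moments show that almost surely \<open>y\<^sub>k = O(k\<^bsup>-q\<^esup>)\<close> for every \<open>q < ph\<close>. Cover each of the first
  \<open>r\<^bsup>-t\<^esup>\<close> points by a set of diameter \<open>r\<^bsup>1/\<theta>\<^esup>\<close> and the interval containing the remaining
  points by sets of diameter \<open>r\<close>, where \<open>(1 - s)/q < t < s/\<theta>\<close>.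

  Lower bound: put the uniform probability measure on \<open>{y\<^sub>k : N \<le> k < 2N}\<close>. By the Cauchy-Schwarz
  inequality, a cover by sets of diameters in \<open>[a, b]\<close> has \<open>s\<close>-sum at least \<open>1/I\<close>, where \<open>I\<close> is the
  energy of the measure for the kernel \<open>max(|d|, a)\<^bsup>-s\<^esup>\<close> cut off at \<open>|d| = b\<close>. The laws of the
  increments give \<open>E I \<le> a\<^bsup>-s\<^esup>/N + C b\<^bsup>1-s\<^esup> N\<^bsup>ph\<^esup>\<close>. For \<open>b = 2\<^bsup>-n\<^esup>\<close>, \<open>a = (b/2)\<^bsup>1/\<theta>\<^esup>\<close> and
  \<open>N = b\<^bsup>-t\<^esup>\<close> with \<open>s/\<theta> < t < (1 - s)/(ph)\<close> this is summable in \<open>n\<close>, so almost surely the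
  energies tend to \<open>0\<close>. Such a \<open>t\<close> exists precisely when \<open>s < \<theta>/(ph + \<theta>)\<close>.

  Monotonicity in \<open>\<theta>\<close> and \<open>s\<close> leaves only countably many null events.
\<close>

section \<open>Covers and their sums\<close>

lemma diameter_atLeastAtMost:
  fixes a b :: real
  assumes "a \<le> b"
  shows "diameter {a..b} = b - a"
  using assms by (simp add: atLeastAtMost_eq_cball)

lemma cover_sum_ge_sum:
  assumes "finite V" "V \<subseteq> \<U>"
  shows "ennreal (\<Sum>U\<in>V. diameter U powr s) \<le> cover_sum s \<U>"
proof -
  have "ennreal (\<Sum>U\<in>V. diameter U powr s) = (\<Sum>U\<in>V. ennreal (diameter U powr s))"
    by simp
  also have "\<dots> \<le> cover_sum s \<U>"
    unfolding cover_sum_def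
    using assms by (auto simp: nonneg_infsum_complete intro!: SUP_upper)
  finally show ?thesis .
qed

lemma cover_sum_finite:
  assumes "finite \<U>"
  shows "cover_sum s \<U> = ennreal (\<Sum>U\<in>\<U>. diameter U powr s)"
  using assms by (simp add: cover_sum_def)

text \<open>On \<open>[0, 1]\<close> the power \<open>x powr s\<close> decreases in
  \<open>s\<close>; diameter 0 is harmless because \<open>0 powr s\<close> is 0 for every
  \<open>s\<close>.\<close>

lemma cover_sum_antimono:
  assumes "\<And>U. U \<in> \<U> \<Longrightarrow> 0 \<le> diameter U" "\<And>U. U \<in> \<U> \<Longrightarrow> diameter U \<le> 1" "s \<le> s'"
  shows "cover_sum s' \<U> \<le> cover_sum s \<U>"
  unfolding cover_sum_def
proof (intro infsum_mono nonneg_summable_on_complete ennreal_leI)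
  fix U assume "U \<in> \<U>"
  then show "diameter U powr s' \<le> diameter U powr s"
    using assms powr_mono'[of s s' "diameter U"] by auto
qed auto

text \<open>Every point of \<open>P\<close> receives its own interval of length
  \<open>\<rho>\<close>, and \<open>{-A..A}\<close> is tiled by intervals of length
  \<open>r\<close>. All diameters are exactly \<open>\<rho>\<close> or \<open>r\<close>, so the
  lower bound on diameters holds as well. With \<open>P\<close> empty and \<open>\<rho> = r\<close>
  this gives finite covers at a single scale.\<close>

lemma finite_interval_cover:
  fixes E P :: "real set"
  assumes "E \<subseteq> P \<union> {-A..A}" "finite P" "0 < \<rho>" "\<rho> \<le> r" "0 \<le> A"
  shows "\<exists>\<U>. finite \<U> \<and> is_cover_within \<rho> r E \<U> \<and>
    cover_sum s \<U> \<le> ennreal (card P * \<rho> powr s + (2 * A / r + 1) * r powr s)"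
proof -
  define n where "n = nat \<lfloor>2 * A / r\<rfloor>"
  define V where "V = (\<lambda>y::real. {y..y + \<rho>}) ` P"
  define W where "W = (\<lambda>i::nat. {-A + i * r..-A + i * r + r}) ` {..n}"
  have r: "0 < r" using assms by simp
  have dV: "bounded U \<and> diameter U = \<rho>" if "U \<in> V" for U
    using that assms by (auto simp: V_def diameter_atLeastAtMost)
  have dW: "bounded U \<and> diameter U = r" if "U \<in> W" for U
    using that r by (auto simp: W_def diameter_atLeastAtMost)
  have fin: "finite V" "finite W" using assms by (auto simp: V_def W_def)
  have "x \<in> \<Union>(V \<union> W)" if "x \<in> E" for x
  proof (cases "x \<in> P")
    case True
    then have "x \<in> {x..x + \<rho>}" "{x..x + \<rho>} \<in> V" using assms by (auto simp: V_def)
    then show ?thesis by blast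
  next
    case False
    then have x: "-A \<le> x" "x \<le> A" using that assms by auto
    define i where "i = nat \<lfloor>(x + A) / r\<rfloor>"
    have i: "real i \<le> (x + A) / r" "(x + A) / r < real i + 1"
      using x r by (auto simp: i_def)
    have "(x + A) / r \<le> 2 * A / r" using x r by (simp add: divide_right_mono)
    then have "i \<le> n" unfolding i_def n_def by (intro nat_mono floor_mono)
    moreover have "x \<in> {-A + i * r..-A + i * r + r}" using i r by (auto simp: field_simps)
    ultimately show ?thesis unfolding W_def by blast
  qed
  then have cov: "is_cover_within \<rho> r E (V \<union> W)"
    unfolding is_cover_within_def
  proof (intro conjI ballI)
    show "countable (V \<union> W)" using fin by (simp add: countable_finite)
    fix U assume "U \<in> V \<union> W"
    then have "bounded U \<and> (diameter U = \<rho> \<or> diameter U = r)" using dV dW by blast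
    then show "bounded U" "\<rho> \<le> diameter U" "diameter U \<le> r" using assms by auto
  qed blast
  \<comment> \<open>Only an inequality: \<open>V\<close> and \<open>W\<close> may share intervals
    when \<open>\<rho> = r\<close>.\<close>
  have "(\<Sum>U\<in>V \<union> W. diameter U powr s) \<le> (\<Sum>U\<in>V. diameter U powr s) + (\<Sum>U\<in>W. diameter U powr s)"
    using fin sum.union_inter[of V W "\<lambda>U. diameter U powr s"]
      sum_nonneg[of "V \<inter> W" "\<lambda>U. diameter U powr s"] by simp
  also have "\<dots> = card V * \<rho> powr s + card W * r powr s"
    using dV dW by simp
  also have "\<dots> \<le> card P * \<rho> powr s + (2 * A / r + 1) * r powr s"
  proof (intro add_mono mult_right_mono)
    show "real (card V) \<le> real (card P)"
      unfolding V_def using assms by (simp add: card_image_le)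
    have "card W \<le> n + 1" unfolding W_def using card_image_le[of "{..n}"] by fastforce
    then have "real (card W) \<le> real n + 1" by linarith
    also have "real n \<le> 2 * A / r" using assms r by (simp add: n_def)
    finally show "real (card W) \<le> 2 * A / r + 1" by simp
  qed auto
  finally have "cover_sum s (V \<union> W) \<le> ennreal (card P * \<rho> powr s + (2 * A / r + 1) * r powr s)"
    using fin by (simp add: cover_sum_finite ennreal_leI)
  with cov fin show ?thesis by blast
qed

text \<open>The deterministic half of the upper bound. Treating about \<open>r powr (-t)\<close>
  points individually costs \<open>r powr (s / \<theta> - t)\<close>; the tail lies within distance
  \<open>C * r powr (t * q)\<close> of 0 and costs about \<open>r powr (t * q + s - 1)\<close>. Some
  \<open>t\<close> makes both exponents positive because \<open>s\<close> exceeds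
  \<open>\<theta> / (q + \<theta>)\<close>.\<close>

lemma eventually_covers_of_decay:
  fixes y :: "nat \<Rightarrow> real"
  assumes y: "\<And>k. k \<ge> 1 \<Longrightarrow> \<bar>y k\<bar> \<le> C * real k powr (-q)"
    and q: "0 < q" and \<theta>: "0 < \<theta>" "\<theta> \<le> 1" and s: "\<theta> / (q + \<theta>) < s" and "0 < \<epsilon>"
  shows "\<exists>r0. 0 < r0 \<and> r0 < 1 \<and> (\<forall>r. 0 < r \<and> r \<le> r0 \<longrightarrow>
    (\<exists>\<U>. is_cover_within (lower_scale \<theta> r) r (insert 0 (y ` {1..})) \<U> \<and>
          cover_sum s \<U> \<le> ennreal \<epsilon>))"
proof -
  have "0 < \<theta> / (q + \<theta>)" using q \<theta> by simp
  then have s0: "0 < s" using s by linarith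
  have C: "0 \<le> C" using y[of 1] by simp
  have "(1 - s) / q < s / \<theta>" using s q \<theta> by (simp add: field_simps)
  then have "max 0 ((1 - s) / q) < s / \<theta>" using s0 \<theta> by simp
  then obtain t where t: "max 0 ((1 - s) / q) < t" "t < s / \<theta>" using dense by blast
  then have t0: "0 < t" and t1: "0 < t * q + s - 1" using q by (auto simp: field_simps)
  \<comment> \<open>The first two terms bound the cost of the single points, the second of them
    accounting for rounding \<open>r powr (-t)\<close> up; the last two are the cost of tiling the
    tail interval.\<close>
  define g where "g r = r powr (s / \<theta> - t) + r powr (s / \<theta>)
     + 2 * C * r powr (t * q + s - 1) + r powr s" for r :: real
  have z: "((\<lambda>r::real. r powr a) \<longlongrightarrow> 0) (at_right 0)" if "0 < a" for a
    by (rule tendsto_zero_powrI[OF _ tendsto_const])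
       (use that in \<open>auto simp: eventually_at_filter\<close>)
  have "(g \<longlongrightarrow> 0 + 0 + 2 * C * 0 + 0) (at_right 0)"
    unfolding g_def using t t1 s0 \<theta>
    by (intro tendsto_add tendsto_mult tendsto_const z) auto
  then have "\<forall>\<^sub>F r in at_right 0. g r < \<epsilon>"
    using \<open>0 < \<epsilon>\<close> by (intro order_tendstoD) auto
  then obtain b where b: "0 < b" "\<And>r. 0 < r \<Longrightarrow> r < b \<Longrightarrow> g r < \<epsilon>"
    by (auto simp: eventually_at_right_field)
  define r0 where "r0 = min (b / 2) (1 / 2)"
  show ?thesis
  proof (intro exI[of _ r0] conjI allI impI)
    fix r assume r: "0 < r \<and> r \<le> r0"
    then have r': "0 < r" "r < b" "r < 1" using b(1) by (auto simp: r0_def)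
    \<comment> \<open>Points with index below \<open>K\<close> are covered singly. Rounding up makes
      the decay bound at every remaining index at most \<open>A\<close>.\<close>
    define K where "K = nat \<lceil>r powr (-t)\<rceil>"
    define A where "A = C * r powr (t * q)"
    define \<rho> where "\<rho> = r powr (1 / \<theta>)"
    have K: "r powr (-t) \<le> real K" "real K \<le> r powr (-t) + 1"
      by (auto simp: K_def)
    have "\<rho> \<le> r powr 1" unfolding \<rho>_def using r' \<theta> by (intro powr_mono') auto
    then have \<rho>: "0 < \<rho>" "\<rho> \<le> r" using r' by (auto simp: \<rho>_def)
    have tail: "\<bar>y k\<bar> \<le> A" if "k \<ge> 1" "K \<le> k" for k
    proof -
      have "r powr (-t) \<le> real k" using K that by linarith
      then have "real k powr (-q) \<le> (r powr (-t)) powr (-q)"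
        using r' q by (intro powr_mono2') auto
      also have "\<dots> = r powr (t * q)" by (simp add: powr_powr)
      finally show ?thesis using y[OF that(1)] C unfolding A_def
        by (meson mult_left_mono order_trans)
    qed
    have A0: "0 \<le> A" using C by (simp add: A_def)
    have "insert 0 (y ` {1..}) \<subseteq> y ` {1..<K} \<union> {-A..A}"
    proof
      fix x assume "x \<in> insert 0 (y ` {1..})"
      then consider "x = 0" | k where "k \<ge> 1" "x = y k" by auto
      then show "x \<in> y ` {1..<K} \<union> {-A..A}"
      proof cases
        case 1 then show ?thesis using A0 by simp
      next
        case 2 then show ?thesis using tail[of k] by (cases "K \<le> k") (auto simp: abs_le_iff)
      qed
    qed
    from finite_interval_cover[OF this _ \<rho> A0, of s]
    obtain \<U> where \<U>: "is_cover_within \<rho> r (insert 0 (y ` {1..})) \<U>"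
      "cover_sum s \<U> \<le> ennreal (card (y ` {1..<K}) * \<rho> powr s + (2 * A / r + 1) * r powr s)"
      by auto
    have "real (card (y ` {1..<K})) \<le> r powr (-t) + 1"
      using card_image_le[of "{1..<K}" y] K by simp
    then have "card (y ` {1..<K}) * \<rho> powr s \<le> (r powr (-t) + 1) * \<rho> powr s"
      by (intro mult_right_mono) auto
    also have "\<dots> = r powr (s / \<theta> - t) + r powr (s / \<theta>)"
      by (simp add: \<rho>_def powr_powr distrib_right powr_add[symmetric])
    finally have 1: "card (y ` {1..<K}) * \<rho> powr s \<le> r powr (s / \<theta> - t) + r powr (s / \<theta>)" .
    have "r powr (t * q + s - 1) = r powr (t * q) * r powr s / r"
      using r' by (simp add: powr_diff powr_add)
    then have 2: "(2 * A / r + 1) * r powr s = 2 * C * r powr (t * q + s - 1) + r powr s"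
      by (simp add: A_def distrib_right)
    have "card (y ` {1..<K}) * \<rho> powr s + (2 * A / r + 1) * r powr s \<le> g r"
      using 1 2 by (simp add: g_def)
    also have "g r < \<epsilon>" using b r' by simp
    finally have "cover_sum s \<U> \<le> ennreal \<epsilon>"
      using \<U>(2) by (meson ennreal_leI less_imp_le order_trans)
    then show "\<exists>\<U>. is_cover_within (lower_scale \<theta> r) r (insert 0 (y ` {1..})) \<U> \<and>
          cover_sum s \<U> \<le> ennreal \<epsilon>"
      using \<U>(1) \<theta> by (auto simp: \<rho>_def lower_scale_def)
  qed (use b in \<open>auto simp: r0_def\<close>)
qed

section \<open>Dimension bounds from cover sums\<close>

lemma lower_scale_mono:
  assumes "0 < \<theta>'" "\<theta>' \<le> \<theta>" "0 < r" "r \<le> 1"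
  shows "lower_scale \<theta>' r \<le> lower_scale \<theta> r"
  using assms powr_mono'[of "1 / \<theta>" "1 / \<theta>'" r] by (simp add: lower_scale_def frac_le)

lemma lower_scale_nonneg: "0 \<le> lower_scale \<theta> r"
  by (simp add: lower_scale_def)

text \<open>If an exponent \<open>s < s'\<close> were admissible at \<open>\<theta>\<close>, there
  would be a cover with \<open>s\<close>-sum at most 1/2. It is also a cover for the weaker lower
  scale of \<open>\<theta>'\<close>, and its \<open>s'\<close>-sum is no larger since all diameters
  are at most 1. Separating \<open>\<theta>'\<close> from \<open>\<theta>\<close> lets a rational
  \<open>\<theta>'\<close> serve all larger \<open>\<theta>\<close>.\<close>

lemma lower_intermediate_dim_ge:
  assumes "0 < \<theta>'" "\<theta>' \<le> \<theta>" "0 < r0"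
    and r0: "\<And>r \<U>. 0 < r \<Longrightarrow> r \<le> r0 \<Longrightarrow> is_cover_within (lower_scale \<theta>' r) r E \<U> \<Longrightarrow> 1 \<le> cover_sum s' \<U>"
  shows "ereal s' \<le> lower_intermediate_dim \<theta> E"
  unfolding lower_intermediate_dim_def
proof (rule Inf_greatest, clarify, rule ccontr)
  fix s :: real
  assume *: "\<forall>\<epsilon>>0. \<forall>r0. 0 < r0 \<and> r0 < 1 \<longrightarrow>
     (\<exists>r \<U>. 0 < r \<and> r \<le> r0 \<and> is_cover_within (lower_scale \<theta> r) r E \<U> \<and> cover_sum s \<U> \<le> ennreal \<epsilon>)"
    and "\<not> ereal s' \<le> ereal s"
  then have "s \<le> s'" by simp
  have "0 < min r0 (1/2)" "min r0 (1/2) < 1" using \<open>0 < r0\<close> by auto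
  then obtain r \<U> where r: "0 < r" "r \<le> min r0 (1/2)"
    "is_cover_within (lower_scale \<theta> r) r E \<U>" "cover_sum s \<U> \<le> ennreal (1/2)"
    using *[rule_format, of "1/2" "min r0 (1/2)"] by auto
  then have r1: "r \<le> 1" "r \<le> r0" by auto
  have "is_cover_within (lower_scale \<theta>' r) r E \<U>"
    using r(3) lower_scale_mono[OF assms(1,2) r(1) r1(1)]
    unfolding is_cover_within_def by (meson order_trans)
  then have "1 \<le> cover_sum s' \<U>" using r0 r(1) r1 by blast
  also have "\<dots> \<le> cover_sum s \<U>"
  proof (rule cover_sum_antimono[OF _ _ \<open>s \<le> s'\<close>])
    fix U assume "U \<in> \<U>"
    then have U: "lower_scale \<theta> r \<le> diameter U" "diameter U \<le> r"
      using r(3) unfolding is_cover_within_def by auto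
    then show "0 \<le> diameter U" using lower_scale_nonneg order_trans by blast
    show "diameter U \<le> 1" using U r1 by simp
  qed
  also have "\<dots> \<le> ennreal (1/2)" by fact
  finally have "ennreal 1 \<le> ennreal (1/2)" by simp
  then show False by (subst (asm) ennreal_le_iff) auto
qed

lemma upper_intermediate_dim_le:
  assumes "0 \<le> s"
    and "\<And>\<epsilon>::real. 0 < \<epsilon> \<Longrightarrow> \<exists>r0. 0 < r0 \<and> r0 < 1 \<and> (\<forall>r. 0 < r \<and> r \<le> r0 \<longrightarrow>
      (\<exists>\<U>. is_cover_within (lower_scale \<theta> r) r E \<U> \<and> cover_sum s \<U> \<le> ennreal \<epsilon>))"
  shows "upper_intermediate_dim \<theta> E \<le> ereal s"
  unfolding upper_intermediate_dim_def using assms by (intro Inf_lower) blast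

text \<open>An exponent admissible for the upper dimension is admissible for the lower one: given a
  bound \<open>r1\<close>, the scale \<open>min r0 r1\<close> works. The infimum over the larger set
  is the smaller one.\<close>

lemma lower_intermediate_dim_le_upper:
  "lower_intermediate_dim \<theta> E \<le> upper_intermediate_dim \<theta> E"
  unfolding lower_intermediate_dim_def upper_intermediate_dim_def
proof (rule Inf_superset_mono, clarify)
  fix s :: real
  assume s: "0 \<le> s" "\<forall>\<epsilon>>0. \<exists>r0>0. r0 < 1 \<and> (\<forall>r. 0 < r \<and> r \<le> r0 \<longrightarrow>
     (\<exists>\<U>. is_cover_within (lower_scale \<theta> r) r E \<U> \<and> cover_sum s \<U> \<le> ennreal \<epsilon>))"
  have "\<exists>r \<U>. 0 < r \<and> r \<le> r1 \<and> is_cover_within (lower_scale \<theta> r) r E \<U> \<and>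
       cover_sum s \<U> \<le> ennreal \<epsilon>" if \<epsilon>: "\<epsilon> > 0" and r1: "0 < r1" for \<epsilon> r1 :: real
  proof -
    obtain r0 where r0: "r0 > 0" "\<And>r. 0 < r \<Longrightarrow> r \<le> r0 \<Longrightarrow>
      (\<exists>\<U>. is_cover_within (lower_scale \<theta> r) r E \<U> \<and> cover_sum s \<U> \<le> ennreal \<epsilon>)"
      using s(2)[rule_format, OF \<epsilon>] by metis
    from r0(2)[of "min r0 r1"] r0(1) r1 show ?thesis
      by (intro exI[of _ "min r0 r1"]) auto
  qed
  with s(1) show "\<exists>s'. ereal s = ereal s' \<and> 0 \<le> s' \<and> (\<forall>\<epsilon>>0. \<forall>r0. 0 < r0 \<and> r0 < 1 \<longrightarrow>
      (\<exists>r \<U>. 0 < r \<and> r \<le> r0 \<and> is_cover_within (lower_scale \<theta> r) r E \<U> \<and>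
              cover_sum s' \<U> \<le> ennreal \<epsilon>))"
    by blast
qed

lemma lower_intermediate_dim_nonneg: "0 \<le> lower_intermediate_dim \<theta> E"
  unfolding lower_intermediate_dim_def by (rule Inf_greatest) auto

text \<open>At \<open>\<theta> = 0\<close> singletons are permitted covering sets, and each
  contributes \<open>0 powr 0 = 0\<close>, so the exponent 0 itself is admissible.\<close>

lemma upper_intermediate_dim_0_countable:
  assumes "countable E"
  shows "upper_intermediate_dim 0 E \<le> 0"
  unfolding zero_ereal_def
proof (rule upper_intermediate_dim_le)
  have "is_cover_within 0 r E ((\<lambda>x. {x}) ` E) \<and> cover_sum 0 ((\<lambda>x. {x}) ` E) \<le> ennreal \<epsilon>"
    if "0 < r" for r \<epsilon> :: real
  proof
    show "is_cover_within 0 r E ((\<lambda>x. {x}) ` E)"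
      using assms that by (auto simp: is_cover_within_def)
    have "cover_sum 0 ((\<lambda>x. {x}) ` E) = (\<Sum>\<^sub>\<infinity>U\<in>(\<lambda>x. {x}) ` E. 0)"
      unfolding cover_sum_def by (rule infsum_cong) auto
    then show "cover_sum 0 ((\<lambda>x. {x}) ` E) \<le> ennreal \<epsilon>" by simp
  qed
  then show "\<exists>r0. 0 < r0 \<and> r0 < 1 \<and> (\<forall>r. 0 < r \<and> r \<le> r0 \<longrightarrow>
      (\<exists>\<U>. is_cover_within (lower_scale 0 r) r E \<U> \<and> cover_sum 0 \<U> \<le> ennreal \<epsilon>))" for \<epsilon> :: real
    by (intro exI[of _ "1/2"]) (auto simp: lower_scale_def)
qed simp

section \<open>Box dimensions from covers by sets of diameter exactly \<open>r\<close>\<close>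

text \<open>On the line, a minimal cover by sets of diameter at most \<open>r\<close> can be
  enlarged to intervals of length exactly \<open>r\<close> without increasing their number. The
  hypothesis then gives that \<open>covering_number E r * r powr s\<close> is at least 1, and taking
  logarithms finishes the proof.\<close>

lemma lower_box_dim_ge:
  fixes E :: "real set"
  assumes "bounded E" "0 < r0"
    and r0: "\<And>r \<U>. 0 < r \<Longrightarrow> r \<le> r0 \<Longrightarrow> is_cover_within r r E \<U> \<Longrightarrow> 1 \<le> cover_sum s \<U>"
  shows "ereal s \<le> lower_box_dim E"
  unfolding lower_box_dim_def
proof (rule Liminf_bounded)
  have "s \<le> ln (real (covering_number E r)) / (- ln r)" if r: "0 < r" "r \<le> r0" "r < 1" for r
  proof -
    obtain A where A: "\<And>x. x \<in> E \<Longrightarrow> \<bar>x\<bar> \<le> A" "0 < A"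
      using \<open>bounded E\<close> by (auto simp: bounded_pos)
    let ?S = "{card \<U> | \<U>. finite \<U> \<and> E \<subseteq> \<Union>\<U> \<and> (\<forall>U\<in>\<U>. bounded U \<and> diameter U \<le> r)}"
    \<comment> \<open>Boundedness provides some finite cover, so the infimum of naturals defining
      the covering number is attained.\<close>
    have "E \<subseteq> {} \<union> {-A..A}" using A(1) by (auto simp: abs_le_iff minus_le_iff)
    then obtain W where W: "finite W" "is_cover_within r r E W"
      using finite_interval_cover[of E "{}" A r r s] r A(2) by auto
    then have "card W \<in> ?S" by (auto simp: is_cover_within_def)
    then have "?S \<noteq> {}" by blast
    then have "covering_number E r \<in> ?S" unfolding covering_number_def by (rule Inf_nat_def1)
    then obtain \<U> where \<U>: "covering_number E r = card \<U>" "finite \<U>" "E \<subseteq> \<Union>\<U>"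
      "\<And>U. U \<in> \<U> \<Longrightarrow> bounded U \<and> diameter U \<le> r" by blast
    define V where "V = (\<lambda>U. {Inf U..Inf U + r}) ` \<U>"
    have "x \<in> {Inf U..Inf U + r}" if "U \<in> \<U>" "x \<in> U" for x U
    proof -
      have b: "bounded U" "diameter U \<le> r" using \<U>(4) that by auto
      have "Inf U \<le> x" using that b by (intro cInf_lower bounded_imp_bdd_below)
      moreover have "x - r \<le> Inf U"
      proof (rule cInf_greatest)
        fix u assume "u \<in> U"
        then have "dist x u \<le> diameter U" using b that by (intro diameter_bounded_bound) auto
        then show "x - r \<le> u" using b by (simp add: dist_real_def)
      qed (use that in auto)
      ultimately show ?thesis by simp
    qed
    then have "E \<subseteq> \<Union>V" using \<U>(3) unfolding V_def by blast
    moreover have V: "finite V" "\<And>U. U \<in> V \<Longrightarrow> bounded U \<and> diameter U = r"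
      using \<U>(2) r by (auto simp: V_def diameter_atLeastAtMost)
    ultimately have "is_cover_within r r E V"
      unfolding is_cover_within_def by (simp add: countable_finite)
    then have "1 \<le> cover_sum s V" using r0 r by blast
    also have "cover_sum s V = ennreal (card V * r powr s)"
      using V by (simp add: cover_sum_finite)
    finally have "1 \<le> card V * r powr s" by simp
    also have "\<dots> \<le> card \<U> * r powr s"
      unfolding V_def using \<U>(2) by (intro mult_right_mono) (auto intro: card_image_le)
    finally have c: "1 \<le> real (card \<U>) * r powr s" .
    \<comment> \<open>Positivity is needed to split the logarithm of the product; a cardinality of 0
      would contradict \<open>c\<close>.\<close>
    then have pos: "0 < real (card \<U>)" by (cases "card \<U> = 0") auto
    have "0 \<le> ln (real (card \<U>) * r powr s)" using c by simp
    also have "\<dots> = ln (real (card \<U>)) + s * ln r"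
      using pos r by (simp add: ln_mult ln_powr)
    finally show ?thesis using r \<U>(1) by (simp add: field_simps)
  qed
  then show "\<forall>\<^sub>F r in at_right 0. ereal s \<le> ereal (ln (real (covering_number E r)) / - ln r)"
    using \<open>0 < r0\<close> unfolding eventually_at_right_field
    by (intro exI[of _ "min r0 1"]) auto
qed

text \<open>All sets of the cover have diameter exactly \<open>r\<close>, so a sum of at most 1
  allows at most \<open>r powr (-s)\<close> of them. This also forces the cover, a priori only
  countable, to be finite.\<close>

lemma upper_box_dim_le:
  assumes "0 \<le> s" "0 < r0"
    and r0: "\<And>r. 0 < r \<Longrightarrow> r \<le> r0 \<Longrightarrow> \<exists>\<U>. is_cover_within r r E \<U> \<and> cover_sum s \<U> \<le> 1"
  shows "upper_box_dim E \<le> ereal s"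
  unfolding upper_box_dim_def
proof (rule Limsup_bounded)
  have "ln (real (covering_number E r)) / (- ln r) \<le> s" if r: "0 < r" "r \<le> r0" "r < 1" for r
  proof -
    obtain \<U> where \<U>: "is_cover_within r r E \<U>" "cover_sum s \<U> \<le> 1" using r0 r by blast
    have d: "bounded U" "diameter U = r" if "U \<in> \<U>" for U
      using \<U>(1) that unfolding is_cover_within_def by (auto intro: antisym)
    have card: "real (card V) \<le> r powr (-s)" if "finite V" "V \<subseteq> \<U>" for V
    proof -
      have "ennreal (card V * r powr s) = ennreal (\<Sum>U\<in>V. diameter U powr s)"
        using d that by (simp add: subset_iff)
      also have "\<dots> \<le> 1" using cover_sum_ge_sum[OF that] \<U>(2) order_trans by blast
      finally have "card V * r powr s \<le> 1" by simp
      then show ?thesis using r by (simp add: powr_minus field_simps)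
    qed
    have "finite \<U>"
    proof (rule ccontr)
      assume "infinite \<U>"
      then obtain V where V: "finite V" "card V = nat \<lceil>r powr (-s)\<rceil> + 1" "V \<subseteq> \<U>"
        using infinite_arbitrarily_large by blast
      have "r powr (-s) \<le> real (nat \<lceil>r powr (-s)\<rceil>)" by (rule real_nat_ceiling_ge)
      then show False using card[OF V(1,3)] unfolding V(2) by linarith
    qed
    then have "covering_number E r \<le> card \<U>"
      unfolding covering_number_def using \<U>(1) d
      by (intro cInf_lower) (auto simp: is_cover_within_def)
    then have c: "real (covering_number E r) \<le> r powr (-s)"
      using card[OF \<open>finite \<U>\<close>] by fastforce
    \<comment> \<open>A vanishing covering number is treated apart: there \<open>ln 0 = 0\<close>,
      and the right-hand side is nonnegative because \<open>r < 1\<close>.\<close>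
    have "ln (real (covering_number E r)) \<le> s * (- ln r)"
    proof (cases "covering_number E r = 0")
      case True
      then show ?thesis using \<open>0 \<le> s\<close> r by (simp add: mult_nonneg_nonpos)
    next
      case False
      then have "ln (real (covering_number E r)) \<le> ln (r powr (-s))"
        using c r by (subst ln_le_cancel_iff) auto
      then show ?thesis using r by (simp add: ln_powr)
    qed
    then show ?thesis using r by (simp add: field_simps)
  qed
  then show "\<forall>\<^sub>F r in at_right 0. ereal (ln (real (covering_number E r)) / - ln r) \<le> ereal s"
    using \<open>0 < r0\<close> unfolding eventually_at_right_field
    by (intro exI[of _ "min r0 1"]) auto
qed

section \<open>Energy of random points\<close>

text \<open>A Riesz kernel adapted to covers with diameters in \<open>[a, b]\<close>. Flooring the
  distance at \<open>a\<close> keeps the diagonal finite; the cut-off at \<open>b\<close> loses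
  nothing for points sharing a covering set and makes expected energies small with
  \<open>b\<close>.\<close>

definition truncated_kernel :: "real \<Rightarrow> real \<Rightarrow> real \<Rightarrow> real \<Rightarrow> real" where
  "truncated_kernel s a b d = (if \<bar>d\<bar> \<le> b then max \<bar>d\<bar> a powr (- s) else 0)"

lemma truncated_kernel_nonneg: "0 \<le> truncated_kernel s a b d"
  by (simp add: truncated_kernel_def)

text \<open>Each index is assigned to one covering set \<open>v\<close> containing its point, and
  \<open>n v\<close> counts the indices assigned to \<open>v\<close>. Cauchy-Schwarz bounds the
  square of the sum of all \<open>n v\<close> by the \<open>s\<close>-sum times the sum of
  \<open>(n v)\<^sup>2 * diameter v powr (- s)\<close>. The latter is at most the energy, as
  \<open>(n v)\<^sup>2\<close> counts pairs in the same set. Indices rather than points are counted,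
  so coinciding values do no harm.\<close>

lemma cover_sum_ge_1_of_energy:
  fixes y :: "'i \<Rightarrow> real"
  assumes A: "finite A" "A \<noteq> {}" and yE: "y ` A \<subseteq> E" and cov: "is_cover_within a' b' E \<U>"
    and ab: "0 < a" "a \<le> a'" "b' \<le> b" and s: "0 \<le> s"
    and energy: "(\<Sum>i\<in>A. \<Sum>j\<in>A. truncated_kernel s a b (y i - y j)) \<le> (real (card A))\<^sup>2"
  shows "1 \<le> cover_sum s \<U>"
proof -
  have "\<forall>i\<in>A. \<exists>U\<in>\<U>. y i \<in> U"
    using yE cov unfolding is_cover_within_def by blast
  then obtain U where U: "\<And>i. i \<in> A \<Longrightarrow> U i \<in> \<U>" "\<And>i. i \<in> A \<Longrightarrow> y i \<in> U i" by metis
  define V where "V = U ` A"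
  have V: "finite V" "V \<subseteq> \<U>" using A U by (auto simp: V_def)
  have d: "bounded v \<and> a \<le> diameter v \<and> diameter v \<le> b" if "v \<in> V" for v
    using cov that V(2) ab unfolding is_cover_within_def by fastforce
  define n where "n v = card {i \<in> A. U i = v}" for v
  let ?S = "\<Sum>v\<in>V. diameter v powr s"
  have "(\<Sum>v\<in>V. (real (n v) * diameter v powr (- s / 2))\<^sup>2)
      = (\<Sum>v\<in>V. \<Sum>i\<in>{i \<in> A. U i = v}. real (n v) * diameter v powr (- s))"
  proof (rule sum.cong[OF refl])
    fix v assume "v \<in> V"
    have "(diameter v powr (- s / 2))\<^sup>2 = diameter v powr (- s)"
      by (simp add: power2_eq_square powr_add[symmetric])
    then show "(real (n v) * diameter v powr (- s / 2))\<^sup>2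
        = (\<Sum>i\<in>{i \<in> A. U i = v}. real (n v) * diameter v powr (- s))"
      by (simp add: power_mult_distrib n_def power2_eq_square[of "real _"])
  qed
  also have "\<dots> = (\<Sum>v\<in>V. \<Sum>i\<in>{i \<in> A. U i = v}. \<Sum>j\<in>{j \<in> A. U j = U i}. diameter (U i) powr (- s))"
    by (intro sum.cong) (auto simp: n_def)
  also have "\<dots> = (\<Sum>i\<in>A. \<Sum>j\<in>{j \<in> A. U j = U i}. diameter (U i) powr (- s))"
    unfolding V_def using A by (intro sum.image_gen[symmetric])
  also have "\<dots> \<le> (\<Sum>i\<in>A. \<Sum>j\<in>{j \<in> A. U j = U i}. truncated_kernel s a b (y i - y j))"
  proof (intro sum_mono)
    fix i j assume i: "i \<in> A" and j: "j \<in> {j \<in> A. U j = U i}"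
    have dU: "bounded (U i)" "a \<le> diameter (U i)" "diameter (U i) \<le> b"
      using d[of "U i"] i by (auto simp: V_def)
    have "dist (y i) (y j) \<le> diameter (U i)"
      using dU U(2)[OF i] U(2)[of j] j by (intro diameter_bounded_bound) auto
    then have 1: "\<bar>y i - y j\<bar> \<le> diameter (U i)" by (simp add: dist_real_def)
    then have "diameter (U i) powr (- s) \<le> max \<bar>y i - y j\<bar> a powr (- s)"
      using dU ab s by (intro powr_mono2') auto
    then show "diameter (U i) powr (- s) \<le> truncated_kernel s a b (y i - y j)"
      using 1 dU by (simp add: truncated_kernel_def)
  qed
  also have "\<dots> \<le> (\<Sum>i\<in>A. \<Sum>j\<in>A. truncated_kernel s a b (y i - y j))"
    using A by (intro sum_mono sum_mono2) (auto simp: truncated_kernel_nonneg)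
  also note energy
  finally have 2: "(\<Sum>v\<in>V. (real (n v) * diameter v powr (- s / 2))\<^sup>2) \<le> (real (card A))\<^sup>2" .
  have "real (card A) = (\<Sum>i\<in>A. 1)" by simp
  also have "\<dots> = (\<Sum>v\<in>V. real (n v))"
    unfolding V_def n_def using A by (subst sum.image_gen[of A _ U]) auto
  \<comment> \<open>The factors \<open>diameter v powr (s / 2)\<close> and its inverse cancel since
    diameters are at least \<open>a > 0\<close>.\<close>
  also have "\<dots> = (\<Sum>v\<in>V. diameter v powr (s / 2) * (real (n v) * diameter v powr (- s / 2)))"
    using d ab by (intro sum.cong) (auto simp: mult.left_commute powr_add[symmetric] dest!: d)
  finally have "(real (card A))\<^sup>2 \<le>
      (\<Sum>v\<in>V. (diameter v powr (s / 2))\<^sup>2) * (\<Sum>v\<in>V. (real (n v) * diameter v powr (- s / 2))\<^sup>2)"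
    using Cauchy_Schwarz_ineq_sum by metis
  also have "(\<Sum>v\<in>V. (diameter v powr (s / 2))\<^sup>2) = ?S"
    by (simp add: power2_eq_square powr_add[symmetric])
  also have "?S * (\<Sum>v\<in>V. (real (n v) * diameter v powr (- s / 2))\<^sup>2) \<le> ?S * (real (card A))\<^sup>2"
    using 2 by (intro mult_left_mono sum_nonneg) auto
  finally have "1 * (real (card A))\<^sup>2 \<le> ?S * (real (card A))\<^sup>2" by simp
  then have "1 \<le> ?S" by (rule mult_right_le_imp_le) (use A in \<open>simp add: card_gt_0_iff\<close>)
  then have "1 \<le> ennreal ?S" by simp
  also have "\<dots> \<le> cover_sum s \<U>" by (rule cover_sum_ge_sum[OF V])
  finally show ?thesis .
qed

section \<open>Gaussian expectations of kernels and moments\<close>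

text \<open>The floor at \<open>a\<close> only lowers the kernel, so its integral is at most that of
  \<open>\<bar>x\<bar> powr (- s)\<close> over \<open>[-b, b]\<close>, computed as two mirror
  images. The bound does not depend on \<open>a\<close>.\<close>

lemma nn_integral_truncated_kernel_le:
  assumes s: "0 < s" "s < 1" and b: "0 < b" and a: "0 < a"
  shows "(\<integral>\<^sup>+x. ennreal (truncated_kernel s a b x) \<partial>lborel) \<le> ennreal (2 * b powr (1 - s) / (1 - s))"
proof -
  define f where "f x = ennreal (x powr (- s)) * indicator {0..b} x" for x :: real
  have meas: "f \<in> borel_measurable borel" unfolding f_def by measurable
  have "((\<lambda>x. x powr (- s)) has_integral b powr (- s + 1) / (- s + 1)) {0..b}"
    using s b by (intro has_integral_powr_from_0) auto
  then have I: "(\<integral>\<^sup>+x. f x \<partial>lborel) = ennreal (b powr (1 - s) / (1 - s))"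
    unfolding f_def by (subst nn_integral_has_integral_lebesgue') auto
  have I': "(\<integral>\<^sup>+x. f (- x) \<partial>lborel) = ennreal (b powr (1 - s) / (1 - s))"
    using nn_integral_real_affine[OF meas, of "-1" 0] I by simp
  \<comment> \<open>The origin has to be discarded: \<open>0 powr (- s)\<close> is 0, while the
    truncated kernel is positive there.\<close>
  have "AE x in lborel. x \<noteq> (0::real)" by (rule AE_lborel_singleton)
  then have "AE x in lborel. ennreal (truncated_kernel s a b x) \<le> f x + f (- x)"
  proof eventually_elim
    case (elim x)
    have "max \<bar>x\<bar> a powr (- s) \<le> \<bar>x\<bar> powr (- s)"
      using elim s by (intro powr_mono2') auto
    then show ?case
      using elim by (cases "0 \<le> x") (auto simp: truncated_kernel_def f_def ennreal_leI)
  qed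
  then have "(\<integral>\<^sup>+x. ennreal (truncated_kernel s a b x) \<partial>lborel) \<le> (\<integral>\<^sup>+x. f x + f (- x) \<partial>lborel)"
    by (rule nn_integral_mono_AE)
  also have "\<dots> = (\<integral>\<^sup>+x. f x \<partial>lborel) + (\<integral>\<^sup>+x. f (- x) \<partial>lborel)"
    using meas by (intro nn_integral_add) auto
  also have "\<dots> = ennreal (2 * b powr (1 - s) / (1 - s))"
    unfolding I I' using s by (simp add: ennreal_plus[symmetric] del: ennreal_plus)
  finally show ?thesis .
qed

lemma normal_density_le:
  assumes "0 < \<sigma>"
  shows "normal_density \<mu> \<sigma> x \<le> 1 / \<sigma>"
proof -
  have "\<sigma> = sqrt (1 * \<sigma>\<^sup>2)" using assms by simp
  also have "\<dots> \<le> sqrt (2 * pi * \<sigma>\<^sup>2)"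
    using pi_gt3 by (intro real_sqrt_le_mono mult_right_mono) auto
  finally have 1: "1 / sqrt (2 * pi * \<sigma>\<^sup>2) \<le> 1 / \<sigma>"
    using assms by (intro divide_left_mono) (auto intro!: mult_pos_pos)
  have "normal_density \<mu> \<sigma> x \<le> 1 / sqrt (2 * pi * \<sigma>\<^sup>2) * 1"
    unfolding normal_density_def by (intro mult_left_mono) auto
  with 1 show ?thesis by simp
qed

lemma measurable_truncated_kernel [measurable]:
  "truncated_kernel s a b \<in> borel_measurable borel"
  unfolding truncated_kernel_def[abs_def] by measurable

text \<open>The Gaussian density is at most \<open>1 / \<sigma>\<close>, which reduces the
  expectation to the Lebesgue integral of the kernel.\<close>

lemma nn_integral_truncated_kernel_normal_le:
  assumes X: "distributed M lborel X (normal_density 0 \<sigma>)" and \<sigma>: "0 < \<sigma>"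
    and s: "0 < s" "s < 1" and b: "0 < b" and a: "0 < a"
  shows "(\<integral>\<^sup>+\<omega>. ennreal (truncated_kernel s a b (X \<omega>)) \<partial>M) \<le> ennreal (2 * b powr (1 - s) / (1 - s) / \<sigma>)"
proof -
  have "(\<integral>\<^sup>+\<omega>. ennreal (truncated_kernel s a b (X \<omega>)) \<partial>M)
      = (\<integral>\<^sup>+x. ennreal (normal_density 0 \<sigma> x) * ennreal (truncated_kernel s a b x) \<partial>lborel)"
    by (rule distributed_nn_integral[OF X, symmetric]) simp
  also have "\<dots> \<le> (\<integral>\<^sup>+x. ennreal (1 / \<sigma>) * ennreal (truncated_kernel s a b x) \<partial>lborel)"
    by (intro nn_integral_mono mult_right_mono ennreal_leI normal_density_le \<sigma>) auto
  also have "\<dots> = ennreal (1 / \<sigma>) * (\<integral>\<^sup>+x. ennreal (truncated_kernel s a b x) \<partial>lborel)"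
    by (intro nn_integral_cmult) auto
  also have "\<dots> \<le> ennreal (1 / \<sigma>) * ennreal (2 * b powr (1 - s) / (1 - s))"
    by (intro mult_left_mono nn_integral_truncated_kernel_le assms) auto
  also have "\<dots> = ennreal (2 * b powr (1 - s) / (1 - s) / \<sigma>)"
    using s \<sigma> by (simp add: ennreal_mult[symmetric])
  finally show ?thesis .
qed

lemma nn_integral_normal_even_moment:
  assumes X: "distributed M lborel X (normal_density 0 \<sigma>)" and \<sigma>: "0 < \<sigma>"
  shows "(\<integral>\<^sup>+\<omega>. ennreal (X \<omega> ^ (2 * m)) \<partial>M) = ennreal (fact (2 * m) / (2 ^ m * fact m) * \<sigma> ^ (2 * m))"
proof -
  have "(\<integral>\<^sup>+\<omega>. ennreal (X \<omega> ^ (2 * m)) \<partial>M)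
      = (\<integral>\<^sup>+x. ennreal (normal_density 0 \<sigma> x) * ennreal (x ^ (2 * m)) \<partial>lborel)"
    by (rule distributed_nn_integral[OF X, symmetric]) simp
  also have "\<dots> = (\<integral>\<^sup>+x. ennreal (normal_density 0 \<sigma> x * (x - 0) ^ (2 * m)) \<partial>lborel)"
    by (simp add: ennreal_mult')
  also have "\<dots> = ennreal (fact (2 * m) / ((2 / \<sigma>\<^sup>2) ^ m * fact m))"
  proof (rule nn_integral_eq_integrable[THEN iffD2])
    show "integrable lborel (\<lambda>x. normal_density 0 \<sigma> x * (x - 0) ^ (2 * m)) \<and>
      (LBINT x. normal_density 0 \<sigma> x * (x - 0) ^ (2 * m)) = fact (2 * m) / ((2 / \<sigma>\<^sup>2) ^ m * fact m)"
      using normal_moment_even[OF \<sigma>, of 0 m] by (simp only: has_bochner_integral_iff)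
  qed (auto simp: power_mult)
  also have "fact (2 * m) / ((2 / \<sigma>\<^sup>2) ^ m * fact m) = fact (2 * m) / (2 ^ m * fact m) * \<sigma> ^ (2 * m)"
    by (simp add: power_mult power_divide)
  finally show ?thesis .
qed

text \<open>The series of the \<open>f n\<close> has finite expectation, hence converges almost
  surely, so its terms tend to 0. This takes the place of a Borel-Cantelli argument in both
  bounds.\<close>

lemma AE_tendsto_0_of_summable_integrals:
  fixes f :: "nat \<Rightarrow> 'a \<Rightarrow> real"
  assumes [measurable]: "\<And>n. f n \<in> borel_measurable M"
    and nonneg: "\<And>n x. 0 \<le> f n x"
    and le: "\<And>n. (\<integral>\<^sup>+x. ennreal (f n x) \<partial>M) \<le> ennreal (c n)"
    and c: "summable c" "\<And>n. 0 \<le> c n"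
  shows "AE x in M. (\<lambda>n. f n x) \<longlonglongrightarrow> 0"
proof -
  have "(\<integral>\<^sup>+x. (\<Sum>n. ennreal (f n x)) \<partial>M) = (\<Sum>n. \<integral>\<^sup>+x. ennreal (f n x) \<partial>M)"
    by (intro nn_integral_suminf) measurable
  also have "\<dots> \<le> (\<Sum>n. ennreal (c n))" by (intro suminf_le le) auto
  also have "\<dots> = ennreal (\<Sum>n. c n)" using c by (simp add: suminf_ennreal2)
  finally have "(\<integral>\<^sup>+x. (\<Sum>n. ennreal (f n x)) \<partial>M) \<noteq> \<infinity>"
    by (auto simp: top_unique)
  then have "AE x in M. (\<Sum>n. ennreal (f n x)) \<noteq> \<infinity>"
    by (intro nn_integral_PInf_AE) auto
  then show ?thesis
  proof eventually_elim
    case (elim x)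
    then have "summable (\<lambda>n. f n x)" using nonneg by (intro summable_suminf_not_top) auto
    then show ?case by (rule summable_LIMSEQ_zero)
  qed
qed

section \<open>Spacing of the points \<open>1 / k powr p\<close>\<close>

lemma powr_MVT:
  fixes x y a :: real
  assumes "0 < x" "x < y"
  obtains z where "x < z" "z < y" "y powr a - x powr a = (y - x) * (a * z powr (a - 1))"
proof -
  have "\<exists>z>x. z < y \<and> y powr a - x powr a = (y - x) * (a * z powr (a - 1))"
    using assms by (intro MVT2) (auto intro!: derivative_eq_intros)
  then show thesis using that by blast
qed

text \<open>Telescoping: by the mean value theorem each term, times \<open>1 - h\<close>, is at most
  the increment of \<open>x powr (1 - h)\<close> over the preceding unit interval.\<close>

lemma sum_powr_le:
  assumes "0 < h" "h < 1"
  shows "(\<Sum>m=1..N. real m powr (- h)) \<le> real N powr (1 - h) / (1 - h)"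
proof (induction N)
  case (Suc N)
  have "(1 - h) * real (Suc N) powr (- h) \<le> real (Suc N) powr (1 - h) - real N powr (1 - h)"
  \<comment> \<open>The first interval starts at 0, where the mean value lemma does not apply; there
    the claim is \<open>1 - h \<le> 1\<close>.\<close>
  proof (cases "N = 0")
    case True
    then show ?thesis using assms by simp
  next
    case False
    obtain z where z: "real N < z" "z < real (Suc N)"
      "real (Suc N) powr (1 - h) - real N powr (1 - h) = (real (Suc N) - real N) * ((1 - h) * z powr (1 - h - 1))"
      by (rule powr_MVT[of "real N" "real (Suc N)" "1 - h"]) (use False in auto)
    have "real (Suc N) powr (- h) \<le> z powr (- h)"
      using z assms by (intro powr_mono2') auto
    then show ?thesis using z(3) assms by simp
  qed
  then show ?case using Suc assms by (simp add: field_simps)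
qed simp

text \<open>The derivative of \<open>x powr (- p)\<close> has absolute value at least
  \<open>p * L powr (- p - 1)\<close> on \<open>(0, L]\<close>.\<close>

lemma power_sequence_gap:
  assumes "0 < p" "1 \<le> i" "1 \<le> j" "i \<le> L" "j \<le> L"
  shows "p * real L powr (- p - 1) * \<bar>real i - real j\<bar> \<le> \<bar>1 / real i powr p - 1 / real j powr p\<bar>"
proof -
  have *: "p * real L powr (- p - 1) * (real j - real i) \<le> 1 / real i powr p - 1 / real j powr p"
    if ij: "1 \<le> i" "i < j" "j \<le> L" for i j
  proof -
    obtain z where z: "real i < z" "z < real j"
      "real j powr (- p) - real i powr (- p) = (real j - real i) * (- p * z powr (- p - 1))"
      by (rule powr_MVT[of "real i" "real j" "- p"]) (use ij in auto)
    have "real L powr (- p - 1) \<le> z powr (- p - 1)"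
      using z ij assms(1) by (intro powr_mono2') auto
    then have "p * real L powr (- p - 1) * (real j - real i) \<le> p * z powr (- p - 1) * (real j - real i)"
      using assms(1) ij by (intro mult_right_mono mult_left_mono) auto
    also have "\<dots> = real i powr (- p) - real j powr (- p)"
      using z(3) by (simp add: algebra_simps)
    finally show ?thesis by (simp add: powr_minus_divide)
  qed
  consider "i < j" | "i = j" | "j < i" by linarith
  then show ?thesis
  proof cases
    case 1
    then have "\<bar>real i - real j\<bar> = real j - real i" by simp
    then show ?thesis using *[OF assms(2) 1 assms(5)] by simp
  next
    case 2
    then show ?thesis by simp
  next
    case 3
    then have "\<bar>real i - real j\<bar> = real i - real j" by simp
    then show ?thesis using *[OF assms(3) 3 assms(4)] by simp
  qed
qed

text \<open>On either side of \<open>i\<close>, the distances to the other indices are distinct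
  integers between 1 and \<open>N\<close>, so each side is bounded by
  \<open>sum_powr_le\<close>.\<close>

lemma sum_gap_powr_le:
  assumes h: "0 < h" "h < 1" and i: "i \<in> {N..<2 * N}"
  shows "(\<Sum>j\<in>{N..<2 * N} - {i}. \<bar>real i - real j\<bar> powr (- h)) \<le> 2 * real N powr (1 - h) / (1 - h)"
proof -
  have half: "(\<Sum>j\<in>J. \<bar>real i - real j\<bar> powr (- h)) \<le> real N powr (1 - h) / (1 - h)"
    if J: "inj_on g J" "g ` J \<subseteq> {1..N}" "\<And>j. j \<in> J \<Longrightarrow> \<bar>real i - real j\<bar> = real (g j)"
    for J and g :: "nat \<Rightarrow> nat"
  proof -
    have "(\<Sum>j\<in>J. \<bar>real i - real j\<bar> powr (- h)) = (\<Sum>j\<in>J. real (g j) powr (- h))"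
      using J(3) by simp
    also have "\<dots> = (\<Sum>m\<in>g ` J. real m powr (- h))" using J(1) by (simp add: sum.reindex)
    also have "\<dots> \<le> (\<Sum>m=1..N. real m powr (- h))" using J(2) by (intro sum_mono2) auto
    also have "\<dots> \<le> real N powr (1 - h) / (1 - h)" by (rule sum_powr_le[OF h])
    finally show ?thesis .
  qed
  have split: "{N..<2 * N} - {i} = {N..<i} \<union> {i<..<2 * N}" using i by auto
  have "(\<Sum>j\<in>{N..<2 * N} - {i}. \<bar>real i - real j\<bar> powr (- h)) =
      (\<Sum>j\<in>{N..<i}. \<bar>real i - real j\<bar> powr (- h)) + (\<Sum>j\<in>{i<..<2 * N}. \<bar>real i - real j\<bar> powr (- h))"
    unfolding split by (intro sum.union_disjoint) auto
  also have "(\<Sum>j\<in>{N..<i}. \<bar>real i - real j\<bar> powr (- h)) \<le> real N powr (1 - h) / (1 - h)"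
  proof (rule half)
    show "inj_on (\<lambda>j. i - j) {N..<i}" by (rule inj_onI) (simp; linarith)
  qed (use i in auto)
  also have "(\<Sum>j\<in>{i<..<2 * N}. \<bar>real i - real j\<bar> powr (- h)) \<le> real N powr (1 - h) / (1 - h)"
  proof (rule half)
    show "inj_on (\<lambda>j. j - i) {i<..<2 * N}" by (rule inj_onI) (simp; linarith)
  qed (use i in auto)
  finally show ?thesis by simp
qed

text \<open>The \<open>N\<close> diagonal pairs contribute \<open>a powr (- s)\<close> each. For the
  others, the Gaussian bound and the gap estimate with \<open>L = 2 * N\<close> give at most a
  constant times \<open>b powr (1 - s) * N powr ((p + 1) * h) * \<bar>i - j\<bar> powr (-
  h)\<close>. Summing a row yields a factor \<open>N powr (1 - h)\<close>, and after normalisation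
  \<open>N powr (p * h)\<close> remains.\<close>

lemma expected_energy_le:
  fixes y :: "nat \<Rightarrow> 'w \<Rightarrow> real"
  assumes M: "prob_space M" and p: "0 < p" and h: "0 < h" "h < 1" and s: "0 < s" "s < 1"
    and [measurable]: "\<And>i. y i \<in> borel_measurable M"
    and y: "\<And>i j. 1 \<le> i \<Longrightarrow> 1 \<le> j \<Longrightarrow> i \<noteq> j \<Longrightarrow>
      distributed M lborel (\<lambda>\<omega>. y i \<omega> - y j \<omega>)
        (normal_density 0 (\<bar>1 / real i powr p - 1 / real j powr p\<bar> powr h))"
  shows "\<exists>C\<ge>0. \<forall>a>0. \<forall>b>0. \<forall>N\<ge>1.
    (\<integral>\<^sup>+\<omega>. ennreal ((\<Sum>i\<in>{N..<2 * N}. \<Sum>j\<in>{N..<2 * N}.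
        truncated_kernel s a b (y i \<omega> - y j \<omega>)) / (real N)\<^sup>2) \<partial>M)
      \<le> ennreal (a powr (- s) / real N + C * b powr (1 - s) * real N powr (p * h))"
proof -
  interpret prob_space M by (rule M)
  \<comment> \<open>\<open>D\<close> collects the constants of the kernel integral and of the gap
    estimate; \<open>C\<close> adds those of the row sum. Neither depends on \<open>a\<close>,
    \<open>b\<close> or \<open>N\<close>.\<close>
  define D where "D = 2 / (1 - s) * p powr (- h) * 2 powr ((p + 1) * h)"
  define C where "C = D * 2 / (1 - h)"
  have D0: "0 \<le> D" using s by (simp add: D_def)
  have C0: "0 \<le> C" using D0 h by (simp add: C_def)
  have "(\<integral>\<^sup>+\<omega>. ennreal ((\<Sum>i\<in>{N..<2 * N}. \<Sum>j\<in>{N..<2 * N}.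
        truncated_kernel s a b (y i \<omega> - y j \<omega>)) / (real N)\<^sup>2) \<partial>M)
      \<le> ennreal (a powr (- s) / real N + C * b powr (1 - s) * real N powr (p * h))"
    if a: "0 < a" and b: "0 < b" and N: "1 \<le> N" for a b N
  proof -
    let ?A = "{N..<2 * N}"
    let ?k = "\<lambda>i j \<omega>. truncated_kernel s a b (y i \<omega> - y j \<omega>)"
    define F where "F = D * b powr (1 - s) * real N powr ((p + 1) * h)"
    have F0: "0 \<le> F" using D0 by (simp add: F_def)
    have diag: "(\<integral>\<^sup>+\<omega>. ennreal (?k i i \<omega>) \<partial>M) \<le> ennreal (a powr (- s))" for i
      using a by (simp add: truncated_kernel_def emeasure_space_1)
    have off: "(\<integral>\<^sup>+\<omega>. ennreal (?k i j \<omega>) \<partial>M) \<le> ennreal (F * \<bar>real i - real j\<bar> powr (- h))"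
      if ij: "i \<in> ?A" "j \<in> ?A" "i \<noteq> j" for i j
    proof -
      let ?x = "\<bar>1 / real i powr p - 1 / real j powr p\<bar>"
      let ?g = "p * (2 * real N) powr (- p - 1) * \<bar>real i - real j\<bar>"
      have g0: "0 < ?g" using p N ij by simp
      have g: "?g \<le> ?x"
        using power_sequence_gap[OF p, of i j "2 * N"] ij N by simp
      have "?x powr (- h) \<le> ?g powr (- h)"
        using g g0 h by (intro powr_mono2') auto
      also have "?g powr (- h) = p powr (- h) * (2 * real N) powr ((p + 1) * h) * \<bar>real i - real j\<bar> powr (- h)"
        using p by (simp add: powr_mult powr_powr algebra_simps)
      also have "(2 * real N) powr ((p + 1) * h) = 2 powr ((p + 1) * h) * real N powr ((p + 1) * h)"
        by (simp add: powr_mult)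
      finally have x: "?x powr (- h) \<le> p powr (- h) * (2 powr ((p + 1) * h) * real N powr ((p + 1) * h))
          * \<bar>real i - real j\<bar> powr (- h)" .
      have "(\<integral>\<^sup>+\<omega>. ennreal (?k i j \<omega>) \<partial>M) \<le> ennreal (2 * b powr (1 - s) / (1 - s) / (?x powr h))"
        using g g0 ij N
        by (intro nn_integral_truncated_kernel_normal_le y s a b) auto
      also have "2 * b powr (1 - s) / (1 - s) / (?x powr h) = 2 * b powr (1 - s) / (1 - s) * ?x powr (- h)"
        by (simp add: powr_minus divide_inverse)
      also have "ennreal \<dots> \<le> ennreal (2 * b powr (1 - s) / (1 - s) *
          (p powr (- h) * (2 powr ((p + 1) * h) * real N powr ((p + 1) * h)) * \<bar>real i - real j\<bar> powr (- h)))"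
        using s by (intro ennreal_leI mult_left_mono x) auto
      also have "\<dots> = ennreal (F * \<bar>real i - real j\<bar> powr (- h))"
        by (simp add: F_def D_def mult_ac)
      finally show ?thesis .
    qed
    have row: "(\<Sum>j\<in>?A. \<integral>\<^sup>+\<omega>. ennreal (?k i j \<omega>) \<partial>M)
        \<le> ennreal (a powr (- s) + F * (2 * real N powr (1 - h) / (1 - h)))" if i: "i \<in> ?A" for i
    proof -
      have "(\<Sum>j\<in>?A. \<integral>\<^sup>+\<omega>. ennreal (?k i j \<omega>) \<partial>M)
          = (\<integral>\<^sup>+\<omega>. ennreal (?k i i \<omega>) \<partial>M) + (\<Sum>j\<in>?A - {i}. \<integral>\<^sup>+\<omega>. ennreal (?k i j \<omega>) \<partial>M)"
        by (rule sum.remove) (use i in auto)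
      also have "\<dots> \<le> ennreal (a powr (- s)) + (\<Sum>j\<in>?A - {i}. ennreal (F * \<bar>real i - real j\<bar> powr (- h)))"
        by (intro add_mono diag sum_mono off) (use i in auto)
      also have "\<dots> = ennreal (a powr (- s) + F * (\<Sum>j\<in>?A - {i}. \<bar>real i - real j\<bar> powr (- h)))"
        using F0 by (simp add: sum_ennreal ennreal_plus sum_distrib_left sum_nonneg)
      also have "\<dots> \<le> ennreal (a powr (- s) + F * (2 * real N powr (1 - h) / (1 - h)))"
        by (intro ennreal_leI add_left_mono mult_left_mono sum_gap_powr_le h i F0)
      finally show ?thesis .
    qed
    have "(\<integral>\<^sup>+\<omega>. ennreal ((\<Sum>i\<in>?A. \<Sum>j\<in>?A. ?k i j \<omega>) / (real N)\<^sup>2) \<partial>M)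
        = (\<integral>\<^sup>+\<omega>. ennreal (1 / (real N)\<^sup>2) * (\<Sum>i\<in>?A. \<Sum>j\<in>?A. ennreal (?k i j \<omega>)) \<partial>M)"
      by (intro nn_integral_cong)
         (simp add: sum_ennreal ennreal_mult[symmetric] sum_nonneg truncated_kernel_nonneg)
    also have "\<dots> = ennreal (1 / (real N)\<^sup>2) * (\<Sum>i\<in>?A. \<Sum>j\<in>?A. \<integral>\<^sup>+\<omega>. ennreal (?k i j \<omega>) \<partial>M)"
      by (simp add: nn_integral_cmult nn_integral_sum)
    also have "\<dots> \<le> ennreal (1 / (real N)\<^sup>2) *
        (\<Sum>i\<in>?A. ennreal (a powr (- s) + F * (2 * real N powr (1 - h) / (1 - h))))"
      by (intro mult_left_mono sum_mono row) auto
    also have "\<dots> = ennreal (1 / (real N)\<^sup>2) * ennreal (real N * (a powr (- s) + F * (2 * real N powr (1 - h) / (1 - h))))"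
      using F0 h by (simp add: ennreal_mult' ennreal_of_nat_eq_real_of_nat)
    also have "\<dots> = ennreal (1 / (real N)\<^sup>2 * (real N * (a powr (- s) + F * (2 * real N powr (1 - h) / (1 - h)))))"
      by (rule ennreal_mult'[symmetric]) simp
    also have "1 / (real N)\<^sup>2 * (real N * (a powr (- s) + F * (2 * real N powr (1 - h) / (1 - h))))
        = a powr (- s) / real N + C * b powr (1 - s) * (real N powr ((p + 1) * h) * real N powr (1 - h) / real N)"
      using N h by (simp add: power2_eq_square F_def C_def field_simps)
    also have "real N powr ((p + 1) * h) * real N powr (1 - h) / real N = real N powr (p * h)"
    proof -
      have "real N powr ((p + 1) * h) * real N powr (1 - h) = real N powr (p * h + 1)"
        by (simp add: powr_add[symmetric] algebra_simps)
      then show ?thesis using N by (simp add: powr_add)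
    qed
    finally show ?thesis .
  qed
  with C0 show ?thesis by blast
qed

section \<open>Almost sure energy and decay estimates\<close>

lemma summable_half_powr:
  assumes "0 < \<alpha>"
  shows "summable (\<lambda>n. ((1/2::real) ^ n) powr \<alpha>)"
proof -
  have "((1/2::real) ^ n) powr \<alpha> = ((1/2) powr \<alpha>) ^ n" for n
    by (simp add: powr_realpow[symmetric] powr_powr mult.commute)
  moreover have "(1/2::real) powr \<alpha> < 1"
    using assms powr_less_mono2[of \<alpha> "1/2" 1] by simp
  ultimately show ?thesis by simp
qed

text \<open>The scale, the cover and the set \<open>E\<close> are quantified inside the event, so
  one null set serves them all. This is possible because the event is implied by the convergence to
  0 of countably many energies, one for each dyadic block of scales.\<close>

lemma AE_cover_sum_ge_1:
  fixes y :: "nat \<Rightarrow> 'w \<Rightarrow> real"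
  assumes M: "prob_space M" and p: "0 < p" and h: "0 < h" "h < 1"
    and meas [measurable]: "\<And>i. y i \<in> borel_measurable M"
    and y: "\<And>i j. 1 \<le> i \<Longrightarrow> 1 \<le> j \<Longrightarrow> i \<noteq> j \<Longrightarrow>
      distributed M lborel (\<lambda>\<omega>. y i \<omega> - y j \<omega>)
        (normal_density 0 (\<bar>1 / real i powr p - 1 / real j powr p\<bar> powr h))"
    and \<theta>: "0 < \<theta>" "\<theta> \<le> 1" and s: "0 < s" "s < \<theta> / (p * h + \<theta>)"
  shows "AE \<omega> in M. \<exists>r0>0. \<forall>r \<U> E. 0 < r \<longrightarrow> r \<le> r0 \<longrightarrow> (\<lambda>i. y i \<omega>) ` {1..} \<subseteq> E \<longrightarrow>
    is_cover_within (lower_scale \<theta> r) r E \<U> \<longrightarrow> 1 \<le> cover_sum s \<U>"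
proof -
  have ph: "0 < p * h" using p h by simp
  then have "\<theta> / (p * h + \<theta>) < 1" using \<theta> by simp
  then have s1: "s < 1" using s by linarith
  obtain C where C: "0 \<le> C" "\<And>a b N. 0 < a \<Longrightarrow> 0 < b \<Longrightarrow> 1 \<le> N \<Longrightarrow>
    (\<integral>\<^sup>+\<omega>. ennreal ((\<Sum>i\<in>{N..<2 * N}. \<Sum>j\<in>{N..<2 * N}.
        truncated_kernel s a b (y i \<omega> - y j \<omega>)) / (real N)\<^sup>2) \<partial>M)
      \<le> ennreal (a powr (- s) / real N + C * b powr (1 - s) * real N powr (p * h))"
    using expected_energy_le[OF M p h s(1) s1 meas y] by blast
  \<comment> \<open>The lower bound on \<open>t\<close> makes the diagonal term decay along the
    dyadic scales, the upper bound the off-diagonal one; these become the two exponents in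
    \<open>c\<close>.\<close>
  have "s / \<theta> < (1 - s) / (p * h)" using s \<theta> ph by (simp add: field_simps)
  then obtain t where t: "s / \<theta> < t" "t < (1 - s) / (p * h)" using dense by blast
  have "0 < s / \<theta>" using s \<theta> by simp
  then have t0: "0 < t" using t by linarith
  have t1: "0 < 1 - s - t * (p * h)" using t ph by (simp add: field_simps)
  define b where "b n = (1/2::real) ^ n" for n
  \<comment> \<open>Half of \<open>b n\<close> is used so that \<open>a n\<close> is below the lower
    scale of every \<open>r\<close> in \<open>[b n / 2, b n]\<close>.\<close>
  define a where "a n = (b n / 2) powr (1 / \<theta>)" for n
  define N where "N n = nat \<lceil>b n powr (- t)\<rceil>" for n
  have b: "0 < b n" "b n \<le> 1" for n by (auto simp: b_def power_le_one)
  have a: "0 < a n" for n using b(1)[of n] by (simp add: a_def)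
  \<comment> \<open>Since this power is at least 1, rounding it up to \<open>N n\<close> at most
    doubles it.\<close>
  have b1: "1 \<le> b n powr (- t)" for n
    using powr_mono2'[of "- t" "b n" 1] b[of n] t0 by simp
  have N: "b n powr (- t) \<le> real (N n)" "real (N n) \<le> 2 * b n powr (- t)" "1 \<le> N n" for n
  proof -
    show 1: "b n powr (- t) \<le> real (N n)" unfolding N_def by (rule real_nat_ceiling_ge)
    have "real (N n) \<le> b n powr (- t) + 1" using b1[of n] by (simp add: N_def)
    then show "real (N n) \<le> 2 * b n powr (- t)" using b1[of n] by linarith
    have "1 \<le> real (N n)" using 1 b1[of n] by linarith
    then show "1 \<le> N n" by simp
  qed
  define f where "f n \<omega> = (\<Sum>i\<in>{N n..<2 * N n}. \<Sum>j\<in>{N n..<2 * N n}.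
      truncated_kernel s (a n) (b n) (y i \<omega> - y j \<omega>)) / (real (N n))\<^sup>2" for n \<omega>
  define c where "c n = 2 powr (s / \<theta>) * b n powr (t - s / \<theta>)
      + C * 2 powr (p * h) * b n powr (1 - s - t * (p * h))" for n
  have "AE \<omega> in M. (\<lambda>n. f n \<omega>) \<longlonglongrightarrow> 0"
  proof (rule AE_tendsto_0_of_summable_integrals)
    show "f n \<in> borel_measurable M" for n unfolding f_def by measurable
    show "0 \<le> f n \<omega>" for n \<omega>
      by (auto simp: f_def intro!: divide_nonneg_nonneg sum_nonneg truncated_kernel_nonneg)
    show "0 \<le> c n" for n using C by (simp add: c_def)
    show "summable c" unfolding c_def b_def
      using t t1 by (intro summable_add summable_mult summable_half_powr) auto
    show "(\<integral>\<^sup>+\<omega>. ennreal (f n \<omega>) \<partial>M) \<le> ennreal (c n)" for n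
    proof -
      have "(\<integral>\<^sup>+\<omega>. ennreal (f n \<omega>) \<partial>M)
          \<le> ennreal (a n powr (- s) / real (N n) + C * b n powr (1 - s) * real (N n) powr (p * h))"
        unfolding f_def by (rule C(2)[OF a b(1) N(3)])
      also have "\<dots> \<le> ennreal (c n)"
        unfolding c_def
      proof (intro ennreal_leI add_mono)
        have "a n powr (- s) = (b n / 2) powr (- (s / \<theta>))" by (simp add: a_def powr_powr)
        also have "\<dots> = b n powr (- (s / \<theta>)) / 2 powr (- (s / \<theta>))"
          by (rule powr_divide)
        also have "\<dots> = b n powr (- (s / \<theta>)) * 2 powr (s / \<theta>)"
          by (simp only: powr_minus[of 2] divide_inverse inverse_inverse_eq)
        also have "\<dots> = 2 powr (s / \<theta>) * b n powr (- (s / \<theta>))" by (rule mult.commute)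
        finally have "a n powr (- s) / real (N n) \<le> 2 powr (s / \<theta>) * b n powr (- (s / \<theta>)) / b n powr (- t)"
          using N(1)[of n] b(1)[of n] by (simp add: frac_le)
        also have "\<dots> = 2 powr (s / \<theta>) * b n powr (t - s / \<theta>)"
          using powr_diff[of "b n" "- (s / \<theta>)" "- t"] by simp
        finally show "a n powr (- s) / real (N n) \<le> 2 powr (s / \<theta>) * b n powr (t - s / \<theta>)" .
        have "real (N n) powr (p * h) \<le> (2 * b n powr (- t)) powr (p * h)"
          using N(2)[of n] ph by (intro powr_mono2) auto
        also have "\<dots> = 2 powr (p * h) * b n powr (- (t * (p * h)))"
          by (simp add: powr_mult powr_powr)
        finally have "C * b n powr (1 - s) * real (N n) powr (p * h)
            \<le> C * b n powr (1 - s) * (2 powr (p * h) * b n powr (- (t * (p * h))))"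
          using C(1) by (intro mult_left_mono) auto
        also have "\<dots> = C * 2 powr (p * h) * b n powr (1 - s - t * (p * h))"
          using powr_add[of "b n" "1 - s" "- (t * (p * h))"] by simp
        finally show "C * b n powr (1 - s) * real (N n) powr (p * h)
            \<le> C * 2 powr (p * h) * b n powr (1 - s - t * (p * h))" .
      qed
      finally show ?thesis .
    qed
  qed
  then show ?thesis
  proof eventually_elim
    case (elim \<omega>)
    then have "\<forall>\<^sub>F n in sequentially. f n \<omega> < 1" by (rule order_tendstoD) simp
    then obtain n0 where n0: "\<And>n. n0 \<le> n \<Longrightarrow> f n \<omega> < 1" by (auto simp: eventually_sequentially)
    have "1 \<le> cover_sum s \<U>"
      if r: "0 < r" "r \<le> b n0" and E: "(\<lambda>i. y i \<omega>) ` {1..} \<subseteq> E"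
        and \<U>: "is_cover_within (lower_scale \<theta> r) r E \<U>" for r \<U> E
    proof -
      have ex: "\<exists>m. b m < r" using real_arch_pow_inv[of r "1/2"] r by (simp add: b_def)
      \<comment> \<open>For the first dyadic scale below \<open>r\<close>, the predecessor
        \<open>n\<close> satisfies \<open>b n / 2 \<le> r \<le> b n\<close>. The choice of
        \<open>n0\<close> as largest scale ensures that \<open>m\<close> is positive and that
        \<open>n\<close> is at least \<open>n0\<close>.\<close>
      define m where "m = (LEAST m. b m < r)"
      have m: "b m < r" unfolding m_def using ex by (rule LeastI_ex)
      have "n0 < m"
      proof (rule ccontr)
        assume "\<not> n0 < m"
        then have "b n0 \<le> b m" unfolding b_def by (intro power_decreasing) auto
        then show False using m r by linarith
      qed
      then obtain n where n: "m = Suc n" "n0 \<le> n" by (cases m) auto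
      have "\<not> b n < r" using not_less_Least[of n "\<lambda>m. b m < r"] n unfolding m_def by simp
      then have rn: "r \<le> b n" "b n / 2 \<le> r" using m n by (auto simp: b_def)
      show ?thesis
      proof (rule cover_sum_ge_1_of_energy[where A = "{N n..<2 * N n}" and y = "\<lambda>i. y i \<omega>" and a = "a n" and b = "b n"])
        show "(\<lambda>i. y i \<omega>) ` {N n..<2 * N n} \<subseteq> E" using E N(3)[of n] by force
        show "{N n..<2 * N n} \<noteq> {}" using N(3)[of n] by auto
        show "is_cover_within (lower_scale \<theta> r) r E \<U>" by fact
        show "a n \<le> lower_scale \<theta> r"
          unfolding a_def lower_scale_def using \<theta> rn b(1)[of n] by (auto intro: powr_mono2)
        have "f n \<omega> \<le> 1" using n0[OF n(2)] by simp
        then show "(\<Sum>i\<in>{N n..<2 * N n}. \<Sum>j\<in>{N n..<2 * N n}.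
            truncated_kernel s (a n) (b n) (y i \<omega> - y j \<omega>)) \<le> (real (card {N n..<2 * N n}))\<^sup>2"
          using N(3)[of n] by (simp add: f_def field_simps)
      qed (use a rn s in auto)
    qed
    then show ?case using b(1)[of n0] by blast
  qed
qed

text \<open>The moment of order \<open>2 * m\<close> of \<open>k powr q * y k\<close> is a constant
  times \<open>k powr (- 2 * m * (\<gamma> - q))\<close>. For large \<open>m\<close> these are
  summable, so the rescaled variables tend to 0 and are in particular bounded.\<close>

lemma AE_power_decay:
  fixes y :: "nat \<Rightarrow> 'w \<Rightarrow> real"
  assumes [measurable]: "\<And>k. y k \<in> borel_measurable M"
    and y: "\<And>k. 1 \<le> k \<Longrightarrow> distributed M lborel (y k) (normal_density 0 (real k powr (- \<gamma>)))"
    and q: "q < \<gamma>"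
  shows "AE \<omega> in M. \<exists>C. \<forall>k\<ge>1. \<bar>y k \<omega>\<bar> \<le> C * real k powr (- q)"
proof -
  \<comment> \<open>This choice gives \<open>2 * m * (\<gamma> - q) > 2\<close>, enough for
    summability.\<close>
  obtain m :: nat where "1 / (\<gamma> - q) < real m" using reals_Archimedean2 by blast
  then have m1: "1 < real m * (\<gamma> - q)" using q by (simp add: field_simps)
  then have m0: "0 < m" by (cases m) auto
  define K :: real where "K = fact (2 * m) / (2 ^ m * fact m)"
  define f where "f n \<omega> = (real (Suc n) powr q * y (Suc n) \<omega>) ^ (2 * m)" for n \<omega>
  have "AE \<omega> in M. (\<lambda>n. f n \<omega>) \<longlonglongrightarrow> 0"
  proof (rule AE_tendsto_0_of_summable_integrals)
    show "f n \<in> borel_measurable M" for n unfolding f_def by measurable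
    show "0 \<le> f n \<omega>" for n \<omega> by (simp add: f_def)
    show "0 \<le> K * real (Suc n) powr (- (real (2 * m) * (\<gamma> - q)))" for n by (simp add: K_def)
    show "summable (\<lambda>n. K * real (Suc n) powr (- (real (2 * m) * (\<gamma> - q))))"
    proof (intro summable_mult)
      have "summable (\<lambda>n. real n powr (- (real (2 * m) * (\<gamma> - q))))"
        using m1 by (subst summable_real_powr_iff) simp
      then show "summable (\<lambda>n. real (Suc n) powr (- (real (2 * m) * (\<gamma> - q))))"
        by (subst summable_Suc_iff)
    qed
    show "(\<integral>\<^sup>+\<omega>. ennreal (f n \<omega>) \<partial>M) \<le> ennreal (K * real (Suc n) powr (- (real (2 * m) * (\<gamma> - q))))" for n
    proof -
      let ?k = "real (Suc n)"
      have pw: "(?k powr e) ^ (2 * m) = ?k powr (real (2 * m) * e)" for e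
        by (simp add: powr_realpow[symmetric] powr_powr mult.commute del: of_nat_Suc)
      have "(\<integral>\<^sup>+\<omega>. ennreal (f n \<omega>) \<partial>M)
          = (\<integral>\<^sup>+\<omega>. ennreal ((?k powr q) ^ (2 * m)) * ennreal (y (Suc n) \<omega> ^ (2 * m)) \<partial>M)"
        by (simp add: f_def power_mult_distrib ennreal_mult' del: of_nat_Suc)
      also have "\<dots> = ennreal ((?k powr q) ^ (2 * m)) * (\<integral>\<^sup>+\<omega>. ennreal (y (Suc n) \<omega> ^ (2 * m)) \<partial>M)"
        by (rule nn_integral_cmult) measurable
      also have "(\<integral>\<^sup>+\<omega>. ennreal (y (Suc n) \<omega> ^ (2 * m)) \<partial>M) = ennreal (K * (?k powr (- \<gamma>)) ^ (2 * m))"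
        unfolding K_def by (rule nn_integral_normal_even_moment[OF y]) auto
      also have "ennreal ((?k powr q) ^ (2 * m)) * \<dots> = ennreal ((?k powr q) ^ (2 * m) * (K * (?k powr (- \<gamma>)) ^ (2 * m)))"
        by (rule ennreal_mult'[symmetric]) simp
      also have "(?k powr q) ^ (2 * m) * (K * (?k powr (- \<gamma>)) ^ (2 * m)) = K * ?k powr (- (real (2 * m) * (\<gamma> - q)))"
      proof -
        have "real (2 * m) * q + real (2 * m) * (- \<gamma>) = - (real (2 * m) * (\<gamma> - q))"
          by (simp add: algebra_simps)
        then have "?k powr (real (2 * m) * q) * ?k powr (real (2 * m) * (- \<gamma>)) = ?k powr (- (real (2 * m) * (\<gamma> - q)))"
          unfolding powr_add[symmetric] by (rule arg_cong)
        then show ?thesis unfolding pw by (simp only: mult.left_commute)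
      qed
      finally show ?thesis by simp
    qed
  qed
  then show ?thesis
  proof eventually_elim
    case (elim \<omega>)
    then have "Bseq (\<lambda>n. f n \<omega>)" by (intro convergent_imp_Bseq convergentI)
    then obtain K' where K': "\<And>n. f n \<omega> \<le> K'" by (auto simp: Bseq_def abs_le_iff)
    \<comment> \<open>The bound \<open>K'\<close> is on the power of order \<open>2 * m\<close>; it
      bounds the base itself only where the base exceeds 1, whence the maximum.\<close>
    have "\<bar>y k \<omega>\<bar> \<le> max 1 K' * real k powr (- q)" if k: "1 \<le> k" for k
    proof -
      obtain n where n: "k = Suc n" using k by (cases k) auto
      let ?z = "real k powr q * y k \<omega>"
      have "\<bar>?z\<bar> \<le> max 1 K'"
      proof (cases "\<bar>?z\<bar> \<le> 1")
        case False
        then have "\<bar>?z\<bar> ^ 1 \<le> \<bar>?z\<bar> ^ (2 * m)" using m0 by (intro power_increasing) auto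
        also have "\<dots> = f n \<omega>" unfolding f_def n by (simp add: power_even_abs)
        also have "\<dots> \<le> K'" by (rule K')
        finally show ?thesis by simp
      qed simp
      then have "real k powr q * \<bar>y k \<omega>\<bar> \<le> max 1 K'" by (simp add: abs_mult)
      then show ?thesis using k by (simp add: powr_minus field_simps)
    qed
    then show ?case by blast
  qed
qed

section \<open>Almost sure dimensions\<close>

lemma ereal_le_if_less_imp_le:
  assumes "\<And>s. s < a \<Longrightarrow> ereal s \<le> z"
  shows "ereal a \<le> z"
proof (rule ccontr)
  assume "\<not> ereal a \<le> z"
  then have "z < ereal a" by simp
  then obtain w where "z < ereal w" "ereal w < ereal a" using ereal_dense2 by blast
  then show False using assms[of w] by simp
qed

lemma le_ereal_if_greater_imp_le:
  assumes "\<And>s. a < s \<Longrightarrow> z \<le> ereal s"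
  shows "z \<le> ereal a"
proof (rule ccontr)
  assume "\<not> z \<le> ereal a"
  then have "ereal a < z" by simp
  then obtain w where "ereal a < ereal w" "ereal w < z" using ereal_dense2 by blast
  then show False using assms[of w] by simp
qed

section \<open>Reduction to rational parameters\<close>

text \<open>By left continuity of \<open>x / (c + x)\<close> at \<open>\<theta>\<close>, a slightly
  smaller rational \<open>\<theta>'\<close> still leaves room for a rational \<open>s'\<close> above
  \<open>s\<close>. The maximum with 0 keeps \<open>s'\<close> positive even if \<open>s\<close> is
  not.\<close>

lemma exists_rat_pair_below:
  fixes c \<theta> s :: real
  assumes "0 < c" "0 < \<theta>" "s < \<theta> / (c + \<theta>)"
  obtains \<theta>' s' where "\<theta>' \<in> \<rat>" "s' \<in> \<rat>" "0 < \<theta>'" "\<theta>' \<le> \<theta>" "0 < s'" "s < s'" "s' < \<theta>' / (c + \<theta>')"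
proof -
  have pos: "0 < \<theta> / (c + \<theta>)" using assms by simp
  have "continuous (at_left \<theta>) (\<lambda>x. x / (c + x))"
    using assms by (intro continuous_intros) auto
  then have "((\<lambda>x. x / (c + x)) \<longlongrightarrow> \<theta> / (c + \<theta>)) (at_left \<theta>)"
    by (simp add: continuous_within)
  then have "\<forall>\<^sub>F x in at_left \<theta>. max 0 s < x / (c + x)"
    using pos assms by (intro order_tendstoD(1)) auto
  then obtain l where l: "l < \<theta>" "\<And>x. l < x \<Longrightarrow> x < \<theta> \<Longrightarrow> max 0 s < x / (c + x)"
    by (auto simp: eventually_at_left_field)
  have "max 0 l < \<theta>" using l assms by simp
  then obtain \<theta>' where \<theta>': "\<theta>' \<in> \<rat>" "max 0 l < \<theta>'" "\<theta>' < \<theta>" using Rats_dense_in_real by blast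
  then have "max 0 s < \<theta>' / (c + \<theta>')" using l by simp
  then obtain s' where "s' \<in> \<rat>" "max 0 s < s'" "s' < \<theta>' / (c + \<theta>')" using Rats_dense_in_real by blast
  with \<theta>' show thesis by (intro that[of \<theta>' s']) auto
qed

lemma exists_rat_below_exponent:
  fixes c \<theta> s :: real
  assumes "0 < c" "0 < \<theta>" "\<theta> / (c + \<theta>) < s"
  obtains q where "q \<in> \<rat>" "0 < q" "q < c" "\<theta> / (q + \<theta>) < s"
proof -
  have "continuous (at_left c) (\<lambda>x. \<theta> / (x + \<theta>))"
    using assms by (intro continuous_intros) auto
  then have "((\<lambda>x. \<theta> / (x + \<theta>)) \<longlongrightarrow> \<theta> / (c + \<theta>)) (at_left c)"
    by (simp add: continuous_within)
  then have "\<forall>\<^sub>F x in at_left c. \<theta> / (x + \<theta>) < s"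
    using assms by (intro order_tendstoD(2)) auto
  then obtain l where l: "l < c" "\<And>x. l < x \<Longrightarrow> x < c \<Longrightarrow> \<theta> / (x + \<theta>) < s"
    by (auto simp: eventually_at_left_field)
  have "max 0 l < c" using l assms by simp
  then obtain q where "q \<in> \<rat>" "max 0 l < q" "q < c" using Rats_dense_in_real by blast
  with l show thesis by (intro that[of q]) auto
qed

text \<open>The deterministic content of the almost sure events, quantified over rational parameters only.\<close>

locale power_decay_sequence =
  fixes y :: "nat \<Rightarrow> real" and c :: real
  assumes c: "0 < c"
    and decay: "\<And>q. q \<in> \<rat> \<Longrightarrow> 0 < q \<Longrightarrow> q < c \<Longrightarrow> \<exists>C. \<forall>k\<ge>1. \<bar>y k\<bar> \<le> C * real k powr (- q)"
    and cover: "\<And>\<theta> s. \<theta> \<in> \<rat> \<Longrightarrow> s \<in> \<rat> \<Longrightarrow> 0 < \<theta> \<Longrightarrow> \<theta> \<le> 1 \<Longrightarrow> 0 < s \<Longrightarrow> s < \<theta> / (c + \<theta>) \<Longrightarrow>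
      \<exists>r0>0. \<forall>r \<U> E. 0 < r \<longrightarrow> r \<le> r0 \<longrightarrow> y ` {1..} \<subseteq> E \<longrightarrow>
        is_cover_within (lower_scale \<theta> r) r E \<U> \<longrightarrow> 1 \<le> cover_sum s \<U>"
begin

abbreviation "points \<equiv> insert 0 (y ` {1..})"

text \<open>Only \<open>q\<close> has to be rational: given the decay, the covers are built
  deterministically for arbitrary real \<open>\<theta>\<close> and \<open>s\<close>.\<close>

lemma covers:
  assumes "0 < \<theta>" "\<theta> \<le> 1" "\<theta> / (c + \<theta>) < s" "0 < \<epsilon>"
  shows "\<exists>r0. 0 < r0 \<and> r0 < 1 \<and> (\<forall>r. 0 < r \<and> r \<le> r0 \<longrightarrow>
    (\<exists>\<U>. is_cover_within (lower_scale \<theta> r) r points \<U> \<and> cover_sum s \<U> \<le> ennreal \<epsilon>))"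
proof -
  obtain q where q: "q \<in> \<rat>" "0 < q" "q < c" "\<theta> / (q + \<theta>) < s"
    using exists_rat_below_exponent[OF c assms(1,3)] .
  obtain C where "\<And>k. 1 \<le> k \<Longrightarrow> \<bar>y k\<bar> \<le> C * real k powr (- q)"
    using decay[OF q(1-3)] by blast
  from eventually_covers_of_decay[OF this q(2) assms(1,2) q(4) assms(4)] show ?thesis .
qed

lemma lower_intermediate_dim_points_ge:
  assumes "0 < \<theta>" "\<theta> \<le> 1"
  shows "ereal (\<theta> / (c + \<theta>)) \<le> lower_intermediate_dim \<theta> points"
proof (rule ereal_le_if_less_imp_le)
  fix s assume "s < \<theta> / (c + \<theta>)"
  then obtain \<theta>' s' where *: "\<theta>' \<in> \<rat>" "s' \<in> \<rat>" "0 < \<theta>'" "\<theta>' \<le> \<theta>" "0 < s'" "s < s'" "s' < \<theta>' / (c + \<theta>')"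
    using exists_rat_pair_below[OF c assms(1)] by metis
  moreover have "\<theta>' \<le> 1" using * assms by simp
  ultimately obtain r0 where r0: "r0 > 0" "\<And>r \<U> E. 0 < r \<Longrightarrow> r \<le> r0 \<Longrightarrow> y ` {1..} \<subseteq> E \<Longrightarrow>
      is_cover_within (lower_scale \<theta>' r) r E \<U> \<Longrightarrow> 1 \<le> cover_sum s' \<U>"
    using cover[of \<theta>' s'] by blast
  have "ereal s' \<le> lower_intermediate_dim \<theta> points"
    by (rule lower_intermediate_dim_ge[OF *(3,4) r0(1)], rule r0(2)) auto
  then show "ereal s \<le> lower_intermediate_dim \<theta> points"
    using * by (meson ereal_less_eq(3) less_imp_le order_trans)
qed

lemma upper_intermediate_dim_points_le:
  assumes "0 < \<theta>" "\<theta> \<le> 1"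
  shows "upper_intermediate_dim \<theta> points \<le> ereal (\<theta> / (c + \<theta>))"
proof (rule le_ereal_if_greater_imp_le)
  fix s assume s: "\<theta> / (c + \<theta>) < s"
  have "0 < \<theta> / (c + \<theta>)" using c assms by simp
  then show "upper_intermediate_dim \<theta> points \<le> ereal s"
    using s by (intro upper_intermediate_dim_le covers assms) auto
qed

lemma intermediate_dim_points:
  assumes "\<theta> \<in> {0..1}"
  shows "lower_intermediate_dim \<theta> points = ereal (\<theta> / (c + \<theta>))"
    and "upper_intermediate_dim \<theta> points = ereal (\<theta> / (c + \<theta>))"
proof -
  have "ereal (\<theta> / (c + \<theta>)) \<le> lower_intermediate_dim \<theta> points \<and>
      upper_intermediate_dim \<theta> points \<le> ereal (\<theta> / (c + \<theta>))"
  \<comment> \<open>At 0 the claimed value is 0, and countability of the point set replaces the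
    cover estimates.\<close>
  proof (cases "\<theta> = 0")
    case True
    have "countable points" by simp
    then show ?thesis
      using True upper_intermediate_dim_0_countable[of points] lower_intermediate_dim_nonneg[of 0 points]
      by (simp add: zero_ereal_def)
  next
    case False
    then show ?thesis
      using assms lower_intermediate_dim_points_ge upper_intermediate_dim_points_le by simp
  qed
  then show "lower_intermediate_dim \<theta> points = ereal (\<theta> / (c + \<theta>))"
    and "upper_intermediate_dim \<theta> points = ereal (\<theta> / (c + \<theta>))"
    using lower_intermediate_dim_le_upper[of \<theta> points] by auto
qed

lemma bounded_points: "bounded points"
proof -
  obtain q where q: "q \<in> \<rat>" "0 < q" "q < c" using Rats_dense_in_real[OF c] by blast
  then obtain C where C: "\<And>k. 1 \<le> k \<Longrightarrow> \<bar>y k\<bar> \<le> C * real k powr (- q)" using decay by blast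
  have C0: "0 \<le> C" using C[of 1] by simp
  have "\<bar>y k\<bar> \<le> C" if k: "1 \<le> k" for k
  proof -
    have "real k powr (- q) \<le> 1" using k q powr_mono2'[of "- q" 1 "real k"] by simp
    then have "C * real k powr (- q) \<le> C * 1" using C0 by (intro mult_left_mono)
    then show ?thesis using C[OF k] by simp
  qed
  then have "bounded (y ` {1..})" by (intro boundedI[of _ C]) auto
  then show ?thesis by simp
qed

text \<open>At \<open>\<theta> = 1\<close> the two scales coincide, so covers have sets of diameter
  exactly \<open>r\<close>. As 1 is rational, only the exponent needs to be rounded.\<close>

lemma box_dim_points:
  "lower_box_dim points = ereal (1 / (c + 1))"
  "upper_box_dim points = ereal (1 / (c + 1))"
proof -
  have scale: "lower_scale 1 r = r" if "0 < r" for r using that by (simp add: lower_scale_def)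
  have "ereal (1 / (c + 1)) \<le> lower_box_dim points"
  proof (rule ereal_le_if_less_imp_le)
    fix s assume "s < 1 / (c + 1)"
    moreover have "0 < 1 / (c + 1)" using c by simp
    ultimately have "max 0 s < 1 / (c + 1)" by simp
    then obtain s' where s': "s' \<in> \<rat>" "max 0 s < s'" "s' < 1 / (c + 1)"
      using Rats_dense_in_real by blast
    then obtain r0 where r0: "r0 > 0" "\<And>r \<U> E. 0 < r \<Longrightarrow> r \<le> r0 \<Longrightarrow> y ` {1..} \<subseteq> E \<Longrightarrow>
        is_cover_within (lower_scale 1 r) r E \<U> \<Longrightarrow> 1 \<le> cover_sum s' \<U>"
      using cover[of 1 s'] by auto
    have "ereal s' \<le> lower_box_dim points"
      by (rule lower_box_dim_ge[OF bounded_points r0(1)], rule r0(2)[where E = points]) (auto simp: scale)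
    then show "ereal s \<le> lower_box_dim points"
      using s' by (meson ereal_less_eq(3) less_imp_le max_less_iff_conj order_trans)
  qed
  moreover have "upper_box_dim points \<le> ereal (1 / (c + 1))"
  proof (rule le_ereal_if_greater_imp_le)
    fix s assume s: "1 / (c + 1) < s"
    have "0 < 1 / (c + 1)" using c by simp
    then have s0: "0 \<le> s" using s by linarith
    obtain r0 where r0: "r0 > 0" "\<And>r. 0 < r \<Longrightarrow> r \<le> r0 \<Longrightarrow>
        \<exists>\<U>. is_cover_within (lower_scale 1 r) r points \<U> \<and> cover_sum s \<U> \<le> ennreal 1"
      using covers[of 1 s 1] s by auto
    show "upper_box_dim points \<le> ereal s"
    proof (rule upper_box_dim_le[OF s0 r0(1)])
      fix r :: real assume "0 < r" "r \<le> r0"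
      then show "\<exists>\<U>. is_cover_within r r points \<U> \<and> cover_sum s \<U> \<le> 1"
        using r0(2)[of r] scale[of r] by simp
    qed
  qed
  moreover have "lower_box_dim points \<le> upper_box_dim points"
    unfolding lower_box_dim_def upper_box_dim_def by (intro Liminf_le_Limsup) simp
  ultimately show "lower_box_dim points = ereal (1 / (c + 1))"
    "upper_box_dim points = ereal (1 / (c + 1))" by auto
qed

end

text \<open>A countable intersection over rational parameters of the events from the decay and
  energy estimates, together with the event that the path starts at 0.\<close>

lemma AE_power_decay_sequence:
  fixes p h :: real
  assumes p: "0 < p" and h: "0 < h" "h < 1" and B: "fractional_brownian_motion M h B"
  shows "AE \<omega> in M. power_decay_sequence (\<lambda>k. B (1 / real k powr p) \<omega>) (p * h)"
proof -
  have M: "prob_space M" and meas: "\<And>x. 0 \<le> x \<Longrightarrow> B x \<in> borel_measurable M"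
    and zero: "AE \<omega> in M. B 0 \<omega> = 0"
    and incr: "\<And>x y. 0 \<le> x \<Longrightarrow> 0 \<le> y \<Longrightarrow> x \<noteq> y \<Longrightarrow>
      distributed M lborel (\<lambda>\<omega>. B x \<omega> - B y \<omega>) (normal_density 0 (\<bar>x - y\<bar> powr h))"
    using B unfolding fractional_brownian_motion_def by auto
  have ph: "0 < p * h" using p h by simp
  define x where "x k = 1 / real k powr p" for k :: nat
  have x0: "0 \<le> x k" for k by (simp add: x_def)
  have [measurable]: "B (x k) \<in> borel_measurable M" "B 0 \<in> borel_measurable M" for k
    using meas x0 by auto
  \<comment> \<open>The law of an increment is prescribed only for distinct times; the gap estimate
    shows that they are distinct.\<close>
  have inj: "x i \<noteq> x j" if "1 \<le> i" "1 \<le> j" "i \<noteq> j" for i j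
  proof -
    have "0 < p * real (max i j) powr (- p - 1) * \<bar>real i - real j\<bar>" using p that by simp
    also have "\<dots> \<le> \<bar>x i - x j\<bar>" unfolding x_def by (rule power_sequence_gap) (use p that in auto)
    finally show ?thesis by auto
  qed
  \<comment> \<open>Decay is first shown for the increments from time 0, whose laws are given;
    \<open>B 0\<close> is removed at the end on the event where it vanishes.\<close>
  have "AE \<omega> in M. \<forall>q\<in>\<rat>. q < p * h \<longrightarrow>
      (\<exists>C. \<forall>k\<ge>1. \<bar>B (x k) \<omega> - B 0 \<omega>\<bar> \<le> C * real k powr (- q))"
  proof (subst AE_ball_countable[OF countable_rat], intro ballI AE_impI)
    fix q assume "q < p * h"
    then show "AE \<omega> in M. \<exists>C. \<forall>k\<ge>1. \<bar>B (x k) \<omega> - B 0 \<omega>\<bar> \<le> C * real k powr (- q)"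
    proof (rule AE_power_decay[rotated 2])
      fix k :: nat assume k: "1 \<le> k"
      have "distributed M lborel (\<lambda>\<omega>. B (x k) \<omega> - B 0 \<omega>) (normal_density 0 (\<bar>x k - 0\<bar> powr h))"
        by (rule incr) (use k in \<open>auto simp: x_def\<close>)
      also have "\<bar>x k - 0\<bar> powr h = real k powr (- (p * h))"
        by (simp add: x_def powr_minus_divide[symmetric] powr_powr)
      finally show "distributed M lborel (\<lambda>\<omega>. B (x k) \<omega> - B 0 \<omega>) (normal_density 0 (real k powr (- (p * h))))" .
    qed measurable
  qed
  moreover have "AE \<omega> in M. \<forall>\<theta>\<in>\<rat>. \<forall>s\<in>\<rat>. 0 < \<theta> \<and> \<theta> \<le> 1 \<and> 0 < s \<and> s < \<theta> / (p * h + \<theta>) \<longrightarrow>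
      (\<exists>r0>0. \<forall>r \<U> E. 0 < r \<longrightarrow> r \<le> r0 \<longrightarrow> (\<lambda>i. B (x i) \<omega>) ` {1..} \<subseteq> E \<longrightarrow>
        is_cover_within (lower_scale \<theta> r) r E \<U> \<longrightarrow> 1 \<le> cover_sum s \<U>)"
  proof (subst AE_ball_countable[OF countable_rat], intro ballI,
      subst AE_ball_countable[OF countable_rat], intro ballI AE_impI)
    fix \<theta> s :: real
    assume *: "0 < \<theta> \<and> \<theta> \<le> 1 \<and> 0 < s \<and> s < \<theta> / (p * h + \<theta>)"
    show "AE \<omega> in M. \<exists>r0>0. \<forall>r \<U> E. 0 < r \<longrightarrow> r \<le> r0 \<longrightarrow> (\<lambda>i. B (x i) \<omega>) ` {1..} \<subseteq> E \<longrightarrow>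
        is_cover_within (lower_scale \<theta> r) r E \<U> \<longrightarrow> 1 \<le> cover_sum s \<U>"
    proof (rule AE_cover_sum_ge_1[OF M p h])
      fix i j :: nat assume "1 \<le> i" "1 \<le> j" "i \<noteq> j"
      then show "distributed M lborel (\<lambda>\<omega>. B (x i) \<omega> - B (x j) \<omega>)
          (normal_density 0 (\<bar>1 / real i powr p - 1 / real j powr p\<bar> powr h))"
        using incr[OF x0 x0 inj, of i j] by (simp add: x_def)
    qed (use * in auto)
  qed
  ultimately show ?thesis using zero
  proof eventually_elim
    case (elim \<omega>)
    show ?case
      unfolding x_def[symmetric]
    proof
      show "0 < p * h" by (rule ph)
      show "\<exists>C. \<forall>k\<ge>1. \<bar>B (x k) \<omega>\<bar> \<le> C * real k powr (- q)" if "q \<in> \<rat>" "q < p * h" for q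
        using elim(1) that elim(3) by simp
      show "\<exists>r0>0. \<forall>r \<U> E. 0 < r \<longrightarrow> r \<le> r0 \<longrightarrow> (\<lambda>k. B (x k) \<omega>) ` {1..} \<subseteq> E \<longrightarrow>
          is_cover_within (lower_scale \<theta> r) r E \<U> \<longrightarrow> 1 \<le> cover_sum s \<U>"
        if "\<theta> \<in> \<rat>" "s \<in> \<rat>" "0 < \<theta>" "\<theta> \<le> 1" "0 < s" "s < \<theta> / (p * h + \<theta>)" for \<theta> s
        using elim(2) that by blast
    qed
  qed
qed

theorem theorem1p1:
  fixes p h :: real and M :: "'w measure" and B :: "real \<Rightarrow> 'w \<Rightarrow> real"
  assumes "p > 0" and "0 < h" and "h < 1"
    and "fractional_brownian_motion M h B"
  shows "(AE \<omega> in M. \<forall>\<theta>\<in>{0..1}.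
            lower_intermediate_dim \<theta> ((\<lambda>x. B x \<omega>) ` power_sequence_set p)
              = ereal (\<theta> / (p * h + \<theta>)) \<and>
            upper_intermediate_dim \<theta> ((\<lambda>x. B x \<omega>) ` power_sequence_set p)
              = ereal (\<theta> / (p * h + \<theta>)))
       \<and> (AE \<omega> in M.
            lower_box_dim ((\<lambda>x. B x \<omega>) ` power_sequence_set p) = ereal (1 / (p * h + 1)) \<and>
            upper_box_dim ((\<lambda>x. B x \<omega>) ` power_sequence_set p) = ereal (1 / (p * h + 1)))"
proof -
  have zero: "AE \<omega> in M. B 0 \<omega> = 0"
    using assms(4) unfolding fractional_brownian_motion_def by auto
  have set: "power_sequence_set p = insert 0 ((\<lambda>k. 1 / real k powr p) ` {1..})"
    unfolding power_sequence_set_def by auto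
  have img: "(\<lambda>x. B x \<omega>) ` power_sequence_set p = insert 0 ((\<lambda>k. B (1 / real k powr p) \<omega>) ` {1..})"
    if "B 0 \<omega> = 0" for \<omega>
    unfolding set using that by (simp add: image_image)
  show ?thesis
  proof
    show "AE \<omega> in M. \<forall>\<theta>\<in>{0..1}.
            lower_intermediate_dim \<theta> ((\<lambda>x. B x \<omega>) ` power_sequence_set p)
              = ereal (\<theta> / (p * h + \<theta>)) \<and>
            upper_intermediate_dim \<theta> ((\<lambda>x. B x \<omega>) ` power_sequence_set p)
              = ereal (\<theta> / (p * h + \<theta>))"
      using AE_power_decay_sequence[OF assms] zero
      by eventually_elim (simp add: img power_decay_sequence.intermediate_dim_points del: One_nat_def)
    show "AE \<omega> in M.
            lower_box_dim ((\<lambda>x. B x \<omega>) ` power_sequence_set p) = ereal (1 / (p * h + 1)) \<and>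
            upper_box_dim ((\<lambda>x. B x \<omega>) ` power_sequence_set p) = ereal (1 / (p * h + 1))"
      using AE_power_decay_sequence[OF assms] zero
      by eventually_elim (simp add: img power_decay_sequence.box_dim_points del: One_nat_def)
  qed
qed

end
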